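(* Let $\Omega$ be a compact topological space, $T:\Omega\to\Omega$ a homeomorphism, and $A:\Omega\to\mathrm{SL}(2,\mathbb{R})$ a continuous map. Then $(T,A)$ is uniformly hyperbolic if and only if there exist $c>0$ and $\lambda>1$ such that $$\|A_n(\omega)\|\ge c\lambda^{n}\quad\text{for all integers } n\ge1\text{ and all }\omega\in\Omega.$$ Moreover, in this case the corresponding unstable and stable directions $u,s:\Omega\to\mathbb{RP}^1$ are continuous on $\Omega$.
   Context: For a set $\Omega$, a bijection $T:\Omega\to\Omega$ and a bounded map $A:\Omega\to\mathrm{SL}(2,\mathbb{R})$, let $(T,A)(\omega,\vec v)=(T\omega,A(\omega)\vec v)$ on $\Omega\times\mathbb{R}^2$, with iterates $(T,A)^n=(T^n,A_n)$: $A_n(\omega)=A(T^{n-1}\omega)\cdots A(\omega)$ for $n\ge1$, $A_0(\omega)=I_2$, and $A_n(\omega)=[A_{-n}(T^{n}\omega)]^{-1}$ for $n\le-1$. $\mathbb{RP}^1=\mathbb{R}/(\pi\mathbb{Z})$ is the set of lines through the origin of $\mathbb{R}^2$ (identified with angles), $B\cdot\theta$ is the induced action of $B\in\mathrm{SL}(2,\mathbb{R})$, and $\vec v\in\theta$ means $\vec v$ lies on the line $\theta$. $(T,A)$ is uniformly hyperbolic if there are maps $u,s:\Omega\to\mathbb{RP}^1$ (the unstable and stable directions; no regularity required) such that (1) $A(\omega)\cdot u(\omega)=u(T\omega)$ and $A(\omega)\cdot s(\omega)=s(T\omega)$ for all $\omega\in\Omega$; (2) there exist $C>0$, $\lambda>1$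 such that $\|A_{-n}(\omega)\vec v\|\le C\lambda^{-n}$ and $\|A_n(\omega)\vec w\|\le C\lambda^{-n}$ for all $n\ge1$, all $\omega\in\Omega$ and all unit vectors $\vec v\in u(\omega)$, $\vec w\in s(\omega)$. *)

theory Defs
  imports "HOL-Analysis.Analysis"
begin

definition SL2 :: "(real^2^2) set" where
  "SL2 = {B. det B = 1}"

(* The cocycle lives on a carrier set \<Omega>; only the values of T and A on \<Omega> matter. *)

definition iterate :: "'a set \<Rightarrow> ('a \<Rightarrow> 'a) \<Rightarrow> int \<Rightarrow> 'a \<Rightarrow> 'a" where
  "iterate \<Omega> T n =
     (if 0 \<le> n then T ^^ nat n else inv_into \<Omega> T ^^ nat (- n))"

primrec forward_cocycle :: "('a \<Rightarrow> 'a) \<Rightarrow> ('a \<Rightarrow> real^2^2) \<Rightarrow> nat \<Rightarrow> 'a \<Rightarrow> real^2^2" where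
  "forward_cocycle T A 0 \<omega> = mat 1"
| "forward_cocycle T A (Suc n) \<omega> = A ((T ^^ n) \<omega>) ** forward_cocycle T A n \<omega>"

definition cocycle ::
  "'a set \<Rightarrow> ('a \<Rightarrow> 'a) \<Rightarrow> ('a \<Rightarrow> real^2^2) \<Rightarrow> int \<Rightarrow> 'a \<Rightarrow> real^2^2" where
  "cocycle \<Omega> T A n \<omega> =
     (if 0 \<le> n then forward_cocycle T A (nat n) \<omega>
      else matrix_inv (forward_cocycle T A (nat (- n)) (iterate \<Omega> T n \<omega>)))"

(* A point of the projective line is a line through the origin, represented as a set of vectors.
   The topology on lines is the quotient topology of \<real> under \<theta> \<mapsto> (the line at angle \<theta>),
   which identifies exactly the angles that agree modulo \<pi>; see line_at_angle_eq_iff and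
   quotient_map_line_at_angle. *)

definition line_at_angle :: "real \<Rightarrow> (real^2) set" where
  "line_at_angle \<theta> = span {vector [cos \<theta>, sin \<theta>]}"

definition lines :: "(real^2) set set" where
  "lines = {L. subspace L \<and> dim L = 1}"

definition RP1 :: "(real^2) set topology" where
  "RP1 = topology (\<lambda>U. U \<subseteq> lines \<and> open {\<theta>. line_at_angle \<theta> \<in> U})"

definition projective_action :: "real^2^2 \<Rightarrow> (real^2) set \<Rightarrow> (real^2) set" where
  "projective_action B L = (\<lambda>v. B *v v) ` L"

definition unstable_stable_directions ::
  "'a set \<Rightarrow> ('a \<Rightarrow> 'a) \<Rightarrow> ('a \<Rightarrow> real^2^2) \<Rightarrow>
   ('a \<Rightarrow> (real^2) set) \<Rightarrow> ('a \<Rightarrow> (real^2) set) \<Rightarrow> bool" where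
  "unstable_stable_directions \<Omega> T A u s \<longleftrightarrow>
     u \<in> \<Omega> \<rightarrow> lines \<and> s \<in> \<Omega> \<rightarrow> lines \<and>
     (\<forall>\<omega>\<in>\<Omega>. projective_action (A \<omega>) (u \<omega>) = u (T \<omega>) \<and>
             projective_action (A \<omega>) (s \<omega>) = s (T \<omega>)) \<and>
     (\<exists>C>0. \<exists>\<rho>>1. \<forall>n::nat. 1 \<le> n \<longrightarrow> (\<forall>\<omega>\<in>\<Omega>.
        (\<forall>v\<in>u \<omega>. norm v = 1 \<longrightarrow> norm (cocycle \<Omega> T A (- int n) \<omega> *v v) \<le> C * \<rho> powi (- int n)) \<and>
        (\<forall>w\<in>s \<omega>. norm w = 1 \<longrightarrow> norm (cocycle \<Omega> T A (int n) \<omega> *v w) \<le> C * \<rho> powi (- int n))))"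

definition uniformly_hyperbolic :: "'a set \<Rightarrow> ('a \<Rightarrow> 'a) \<Rightarrow> ('a \<Rightarrow> real^2^2) \<Rightarrow> bool" where
  "uniformly_hyperbolic \<Omega> T A \<longleftrightarrow> (\<exists>u s. unstable_stable_directions \<Omega> T A u s)"

lemma angle_vector_nonzero: "vector [cos \<theta>, sin \<theta>] \<noteq> (0::real^2)"
proof
  assume "vector [cos \<theta>, sin \<theta>] = (0::real^2)"
  then have "cos \<theta> = 0" "sin \<theta> = 0"
    by (metis vector_2(1) zero_index, metis vector_2(2) zero_index)
  then show False
    using sin_cos_squared_add[of \<theta>] by simp
qed

lemma line_at_angle_in_lines: "line_at_angle \<theta> \<in> lines"
  by (simp add: line_at_angle_def lines_def dim_span angle_vector_nonzero del: vec.dim_span)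

lemma line_at_angle_surj: "range line_at_angle = lines"
proof
  show "range line_at_angle \<subseteq> lines"
    using line_at_angle_in_lines by blast
  show "lines \<subseteq> range line_at_angle"
  proof
    fix L assume "L \<in> lines"
    then have L: "subspace L" "dim L = 1"
      by (auto simp: lines_def)
    then obtain v where v: "v \<in> L" "v \<noteq> 0"
      by (metis dim_eq_0 singletonI subsetI zero_neq_one)
    define r where "r = norm v"
    have "r > 0"
      using v by (simp add: r_def)
    moreover have "r\<^sup>2 = (v$1)\<^sup>2 + (v$2)\<^sup>2"
      by (simp add: r_def norm_vec_def L2_set_def sum_2)
    ultimately have "(v$1 / r)\<^sup>2 + (v$2 / r)\<^sup>2 = 1"
      by (metis add_divide_distrib div_self less_irrefl power_divide zero_eq_power2)
    then obtain t where t: "v$1 / r = cos t" "v$2 / r = sin t"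
      using sincos_total_2pi_le by blast
    have eq: "vector [cos t, sin t] = (1 / r) *\<^sub>R v"
      by (simp add: vec_eq_iff forall_2 t[symmetric])
    have "line_at_angle t \<subseteq> L"
      unfolding line_at_angle_def eq
      using L v by (simp add: span_minimal subspace_scale)
    moreover have "dim (line_at_angle t) = 1" "subspace (line_at_angle t)"
      using line_at_angle_in_lines by (auto simp: lines_def)
    ultimately have "line_at_angle t = L"
      using L by (intro subspace_dim_equal) auto
    then show "L \<in> range line_at_angle"
      by blast
  qed
qed

lemma line_at_angle_eq_iff:
  "line_at_angle \<theta> = line_at_angle \<phi> \<longleftrightarrow> (\<exists>k::int. \<theta> - \<phi> = of_int k * pi)"
proof
  assume "line_at_angle \<theta> = line_at_angle \<phi>"
  then have "vector [cos \<theta>, sin \<theta>] \<in> span {vector [cos \<phi>, sin \<phi>] :: real^2}"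
    unfolding line_at_angle_def by (metis insertI1 span_base)
  then obtain c where "vector [cos \<theta>, sin \<theta>] = c *\<^sub>R (vector [cos \<phi>, sin \<phi>] :: real^2)"
    by (auto simp: span_singleton)
  then have "cos \<theta> = c * cos \<phi>" "sin \<theta> = c * sin \<phi>"
    by (simp_all add: vec_eq_iff forall_2)
  then have "sin (\<theta> - \<phi>) = 0"
    by (simp add: sin_diff)
  then show "\<exists>k::int. \<theta> - \<phi> = of_int k * pi"
    by (simp add: sin_zero_iff_int2)
next
  assume "\<exists>k::int. \<theta> - \<phi> = of_int k * pi"
  then have sin0: "sin (\<theta> - \<phi>) = 0"
    by (simp add: sin_zero_iff_int2)
  define c where "c = cos (\<theta> - \<phi>)"
  have c: "c \<noteq> 0"
    using sin0 sin_cos_squared_add[of "\<theta> - \<phi>"] by (auto simp: c_def)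
  have "cos (\<theta> - \<phi> + \<phi>) = c * cos \<phi>" "sin (\<theta> - \<phi> + \<phi>) = c * sin \<phi>"
    unfolding cos_add sin_add c_def using sin0 by simp_all
  then have eq: "vector [cos \<theta>, sin \<theta>] = c *\<^sub>R (vector [cos \<phi>, sin \<phi>] :: real^2)"
    by (simp add: vec_eq_iff forall_2)
  show "line_at_angle \<theta> = line_at_angle \<phi>"
    unfolding line_at_angle_def eq using c by (simp add: span_image_scale[of "{_}" "\<lambda>_. c", simplified])
qed

lemma openin_RP1: "openin RP1 U \<longleftrightarrow> U \<subseteq> lines \<and> open {\<theta>. line_at_angle \<theta> \<in> U}"
proof -
  have "istopology (\<lambda>U. U \<subseteq> lines \<and> open {\<theta>. line_at_angle \<theta> \<in> U})"
    unfolding istopology_def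
  proof (intro conjI allI impI)
    fix S T
    assume "S \<subseteq> lines \<and> open {\<theta>. line_at_angle \<theta> \<in> S}"
      and "T \<subseteq> lines \<and> open {\<theta>. line_at_angle \<theta> \<in> T}"
    then show "S \<inter> T \<subseteq> lines" "open {\<theta>. line_at_angle \<theta> \<in> S \<inter> T}"
      by (auto simp: Collect_conj_eq intro: open_Int)
  next
    fix \<K>
    assume K: "\<forall>K\<in>\<K>. K \<subseteq> lines \<and> open {\<theta>. line_at_angle \<theta> \<in> K}"
    then show "\<Union>\<K> \<subseteq> lines"
      by blast
    have "{\<theta>. line_at_angle \<theta> \<in> \<Union>\<K>} = (\<Union>K\<in>\<K>. {\<theta>. line_at_angle \<theta> \<in> K})"
      by blast
    then show "open {\<theta>. line_at_angle \<theta> \<in> \<Union>\<K>}"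
      using K by auto
  qed
  then show ?thesis
    unfolding RP1_def by (simp add: topology_inverse')
qed

lemma topspace_RP1: "topspace RP1 = lines"
proof (rule antisym)
  show "topspace RP1 \<subseteq> lines"
    using openin_RP1 openin_topspace by blast
  have "openin RP1 lines"
    by (simp add: openin_RP1 line_at_angle_in_lines)
  then show "lines \<subseteq> topspace RP1"
    by (rule openin_subset)
qed

lemma quotient_map_line_at_angle: "quotient_map euclidean RP1 line_at_angle"
  by (simp add: quotient_map_def topspace_RP1 openin_RP1 line_at_angle_surj)

end

theory Submission
  imports Defs
begin

text \<open>
  Write \<open>B n\<close> for the cocycle along one forward orbit and let \<open>s n\<close> be a direction that
  \<open>B n\<close> contracts most. In dimension two, \<open>\<bar>wedge x y\<bar> \<le> \<bar>B n x\<bar> \<bar>B n y\<bar>\<close> because \<open>det (B n) = 1\<close>, so the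
  sine of the angle between \<open>s n\<close> and \<open>s (n + 1)\<close> is \<open>O(\<bar>B n\<bar>\<^sup>-\<^sup>2)\<close>. Hence these directions converge
  to the line of all \<open>w\<close> with \<open>\<bar>B n w\<bar> / \<bar>B n\<bar> \<longlonglongrightarrow> 0\<close>, and this description makes invariance evident.

  The bound this gives for \<open>\<bar>B n w\<bar>\<close> is \<open>O(\<bar>B n\<bar> \<Sum>j\<ge>n. \<bar>B j\<bar>\<^sup>-\<^sup>2)\<close>, which is useless when the norms
  drop after time \<open>n\<close>. But if \<open>\<bar>B n\<bar>\<close> grows at least like \<open>\<rho> ^ n\<close>, every window \<open>[N, N']\<close> with \<open>N'\<close> large
  contains a time \<open>n\<close> (a minimum of \<open>\<bar>B k\<bar> / (sqrt \<rho>) ^ k\<close>) after which the norms grow at rate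
  \<open>sqrt \<rho>\<close>, and then \<open>\<bar>B n w\<bar> = O(1 / \<bar>B n\<bar>) \<le> 1/2\<close>. As \<open>N'\<close> is uniform over all orbits,
  invariance turns this into uniform exponential decay. The unstable direction is the stable
  direction of the inverse cocycle. Continuity follows from
  \<open>\<bar>wedge v w\<bar> \<le> \<bar>B n y v\<bar> \<bar>B n y w\<bar>\<close> for \<open>v\<close> stable at \<open>y\<close> and \<open>w\<close> stable at a nearby point.
\<close>

section \<open>Unimodular matrices of size two\<close>

text \<open>The determinant of two plane vectors. For unit vectors
  \<open>\<bar>wedge x y\<bar>\<close> is the sine of the angle between the lines they span, so it
  measures distances of lines without a choice of sign.\<close>

definition wedge :: "real^2 \<Rightarrow> real^2 \<Rightarrow> real" where
  "wedge x y = x$1 * y$2 - x$2 * y$1"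

lemma power2_norm_vec2: "(norm (x::real^2))\<^sup>2 = (x$1)\<^sup>2 + (x$2)\<^sup>2"
  by (simp add: norm_vec_def L2_set_def sum_2)

lemma power2_norm_mat2:
  "(norm (B::real^2^2))\<^sup>2 = (B$1$1)\<^sup>2 + (B$1$2)\<^sup>2 + (B$2$1)\<^sup>2 + (B$2$2)\<^sup>2"
proof -
  have "(norm B)\<^sup>2 = (norm (B$1))\<^sup>2 + (norm (B$2))\<^sup>2"
    by (simp add: norm_vec_def[where 'b=2 and 'a="real^2"] L2_set_def sum_2)
  then show ?thesis
    by (simp add: power2_norm_vec2)
qed

lemma matrix_vector_mult_2:
  fixes B :: "real^2^2"
  shows "(B *v x)$1 = B$1$1 * x$1 + B$1$2 * x$2" "(B *v x)$2 = B$2$1 * x$1 + B$2$2 * x$2"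
  by (simp_all add: matrix_vector_mult_def sum_2)

lemma matrix_matrix_mult_2:
  fixes B :: "real^2^2"
  shows "(B ** C)$i$j = B$i$1 * C$1$j + B$i$2 * C$2$j"
  by (simp add: matrix_matrix_mult_def sum_2)

lemma wedge_matrix_mult: "wedge (B *v x) (B *v y) = det B * wedge x y"
  by (simp add: wedge_def matrix_vector_mult_2 det_2 algebra_simps)

text \<open>Lagrange's identity: the squares of \<open>wedge\<close> and of the inner product add up
  to the product of the squared norms.\<close>

lemma abs_wedge_le: "\<bar>wedge x y\<bar> \<le> norm x * norm y"
proof (rule power2_le_imp_le)
  have "(norm x)\<^sup>2 * (norm y)\<^sup>2 = (wedge x y)\<^sup>2 + (x$1 * y$1 + x$2 * y$2)\<^sup>2"
    unfolding power2_norm_vec2 wedge_def by (simp add: power2_eq_square algebra_simps)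
  then show "\<bar>wedge x y\<bar>\<^sup>2 \<le> (norm x * norm y)\<^sup>2"
    by (simp add: power_mult_distrib)
qed simp

text \<open>Three vectors of the plane are linearly dependent, with their wedges as coefficients;
  taking norms in this relation gives the bound.\<close>

lemma wedge_triangle:
  assumes "norm x = 1" "norm y = 1" "norm z = 1"
  shows "\<bar>wedge x z\<bar> \<le> \<bar>wedge x y\<bar> + \<bar>wedge y z\<bar>"
proof -
  have "wedge x z *\<^sub>R y = wedge x y *\<^sub>R z + wedge y z *\<^sub>R x"
    by (simp add: vec_eq_iff forall_2 wedge_def algebra_simps)
  then have "norm (wedge x z *\<^sub>R y) \<le> norm (wedge x y *\<^sub>R z) + norm (wedge y z *\<^sub>R x)"
    by (metis norm_triangle_ineq)
  then show ?thesis
    by (simp add: assms)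
qed

text \<open>
  The norm of the type \<open>real^2^2\<close> is the Frobenius norm. It replaces the operator norm below because it
  is given by a polynomial in the entries and is invariant under inversion on \<open>SL2\<close>.
\<close>

lemma norm_matrix_vector_mult_le:
  fixes B :: "real^2^2"
  shows "norm (B *v x) \<le> norm B * norm x"
proof (rule power2_le_imp_le)
  have "(norm B * norm x)\<^sup>2 - (norm (B *v x))\<^sup>2 =
    (B$1$1 * x$2 - B$1$2 * x$1)\<^sup>2 + (B$2$1 * x$2 - B$2$2 * x$1)\<^sup>2"
    unfolding power_mult_distrib power2_norm_mat2 power2_norm_vec2 matrix_vector_mult_2
    by (simp add: power2_eq_square algebra_simps)
  then show "(norm (B *v x))\<^sup>2 \<le> (norm B * norm x)\<^sup>2"
    by (smt (verit) sum_power2_ge_zero)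
qed simp

text \<open>Cauchy-Schwarz for every row of \<open>B\<close> against every column of
  \<open>C\<close>; the defect is the sum of the squared determinants they form.\<close>

lemma norm_matrix_mult_le:
  fixes B C :: "real^2^2"
  shows "norm (B ** C) \<le> norm B * norm C"
proof (rule power2_le_imp_le)
  have "(norm B * norm C)\<^sup>2 - (norm (B ** C))\<^sup>2 =
    (B$1$1 * C$2$1 - B$1$2 * C$1$1)\<^sup>2 + (B$2$1 * C$2$1 - B$2$2 * C$1$1)\<^sup>2
    + ((B$1$1 * C$2$2 - B$1$2 * C$1$2)\<^sup>2 + (B$2$1 * C$2$2 - B$2$2 * C$1$2)\<^sup>2)"
    unfolding power_mult_distrib power2_norm_mat2 matrix_matrix_mult_2
    by (simp add: power2_eq_square algebra_simps)
  then show "(norm (B ** C))\<^sup>2 \<le> (norm B * norm C)\<^sup>2"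
    by (smt (verit) sum_power2_ge_zero)
qed simp

lemma norm_mat2_le_sum:
  fixes B :: "real^2^2"
  shows "norm B \<le> norm (B *v axis 1 1) + norm (B *v axis 2 1)"
proof (rule power2_le_imp_le)
  have "(norm B)\<^sup>2 = (norm (B *v axis 1 1))\<^sup>2 + (norm (B *v axis 2 1))\<^sup>2"
    by (simp add: power2_norm_mat2 power2_norm_vec2 matrix_vector_mult_2 axis_def)
  then show "(norm B)\<^sup>2 \<le> (norm (B *v axis 1 1) + norm (B *v axis 2 1))\<^sup>2"
    by (simp add: power2_sum)
qed simp

text \<open>With \<open>onorm_le_norm_mat2\<close> this transfers growth between the operator norm
  and the Frobenius norm, at the cost of a constant.\<close>

lemma norm_mat2_le_onorm:
  fixes B :: "real^2^2"
  shows "norm B \<le> 2 * onorm (\<lambda>v. B *v v)"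
proof -
  have "bounded_linear (\<lambda>v. B *v v)"
    by (rule matrix_vector_mul_bounded_linear)
  then have "norm (B *v axis i 1) \<le> onorm (\<lambda>v. B *v v)" for i
    using onorm[of "\<lambda>v. B *v v" "axis i 1"] by simp
  from this[of 1] this[of 2] show ?thesis
    using norm_mat2_le_sum[of B] by simp
qed

lemma onorm_le_norm_mat2:
  fixes B :: "real^2^2"
  shows "onorm (\<lambda>v. B *v v) \<le> norm B"
  by (intro onorm_bound norm_matrix_vector_mult_le norm_ge_zero)

text \<open>Decompose \<open>x\<close> along \<open>s\<close> and along \<open>p\<close>, which is
  \<open>s\<close> turned by a right angle: the coefficients are the cosine
  \<open>s \<bullet> x\<close> and the sine \<open>wedge s x\<close>. If \<open>B\<close> contracts
  \<open>s\<close>, only the angle from \<open>s\<close> to \<open>x\<close> can make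
  \<open>B *v x\<close> large.\<close>

lemma norm_matrix_mult_wedge_le:
  assumes "norm s = 1" "norm x = 1"
  shows "norm (B *v x) \<le> norm (B *v s) + norm (B::real^2^2) * \<bar>wedge s x\<bar>"
proof -
  define p :: "real^2" where "p = vector [- s$2, s$1]"
  have s: "s$1 * s$1 + s$2 * s$2 = 1"
    using power2_norm_vec2[of s] assms by (simp add: power2_eq_square)
  have p: "norm p = 1"
    using power2_norm_vec2[of s] power2_norm_vec2[of p] assms
    by (intro power2_eq_imp_eq[of "norm p" 1]) (simp_all add: p_def)
  have "x$1 = (s \<bullet> x) * s$1 - wedge s x * s$2" "x$2 = (s \<bullet> x) * s$2 + wedge s x * s$1"
    using s unfolding wedge_def inner_vec_def sum_2 by (simp; algebra)+
  then have "x = (s \<bullet> x) *\<^sub>R s + wedge s x *\<^sub>R p"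
    by (simp add: vec_eq_iff forall_2 p_def)
  then have "B *v x = (s \<bullet> x) *\<^sub>R (B *v s) + wedge s x *\<^sub>R (B *v p)"
    by (metis matrix_vector_mult_add_rdistrib matrix_vector_mult_scaleR matrix_vector_right_distrib)
  then have "norm (B *v x) \<le> \<bar>s \<bullet> x\<bar> * norm (B *v s) + \<bar>wedge s x\<bar> * norm (B *v p)"
    using norm_triangle_ineq[of "(s \<bullet> x) *\<^sub>R (B *v s)" "wedge s x *\<^sub>R (B *v p)"] by simp
  also have "\<bar>s \<bullet> x\<bar> * norm (B *v s) \<le> 1 * norm (B *v s)"
    using Cauchy_Schwarz_ineq2[of s x] assms by (intro mult_right_mono) auto
  also have "\<bar>wedge s x\<bar> * norm (B *v p) \<le> \<bar>wedge s x\<bar> * norm B"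
    using norm_matrix_vector_mult_le[of B p] p by (intro mult_left_mono) auto
  finally show ?thesis
    by (simp add: mult.commute)
qed

section \<open>The group \<open>SL2\<close>: inverses, norms and contracted directions\<close>

lemma SL2_mult: "B \<in> SL2 \<Longrightarrow> C \<in> SL2 \<Longrightarrow> B ** C \<in> SL2"
  by (simp add: SL2_def det_mul)

lemma wedge_SL2: "B \<in> SL2 \<Longrightarrow> wedge (B *v x) (B *v y) = wedge x y"
  by (simp add: SL2_def wedge_matrix_mult)

lemma abs_wedge_le_SL2: "B \<in> SL2 \<Longrightarrow> \<bar>wedge x y\<bar> \<le> norm (B *v x) * norm (B *v y)"
  using abs_wedge_le[of "B *v x" "B *v y"] by (simp add: wedge_SL2)

lemma
  assumes "B \<in> SL2"
  shows matrix_inv_SL2: "matrix_inv B = vector [vector [B$2$2, - B$1$2], vector [- B$2$1, B$1$1]]"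
      (is "_ = ?C")
    and matrix_inv_SL2_left: "matrix_inv B ** B = mat 1"
    and matrix_inv_SL2_right: "B ** matrix_inv B = mat 1"
proof -
  have det: "B$1$1 * B$2$2 - B$1$2 * B$2$1 = 1"
    using assms by (simp add: SL2_def det_2)
  have C: "B ** ?C = mat 1" "?C ** B = mat 1"
    using det by (simp_all add: vec_eq_iff forall_2 matrix_matrix_mult_2 mat_def mult.commute)
  \<comment> \<open>\<open>matrix_inv\<close> is a Hilbert choice, so \<open>?C\<close> must first
    witness that an inverse exists; uniqueness of inverses then yields the explicit formula.\<close>
  have inv: "B ** matrix_inv B = mat 1 \<and> matrix_inv B ** B = mat 1"
    unfolding matrix_inv_def by (rule someI[of _ ?C]) (use C in simp)
  then show "matrix_inv B ** B = mat 1" "B ** matrix_inv B = mat 1"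
    by auto
  have "matrix_inv B = matrix_inv B ** (B ** ?C)"
    by (simp add: C)
  also have "\<dots> = ?C"
    by (simp add: matrix_mul_assoc inv)
  finally show "matrix_inv B = ?C" .
qed

lemma matrix_inv_in_SL2: "B \<in> SL2 \<Longrightarrow> matrix_inv B \<in> SL2"
  by (simp add: matrix_inv_SL2) (simp add: SL2_def det_2 mult.commute)

lemma matrix_inv_mult_SL2:
  assumes "B \<in> SL2" "C \<in> SL2"
  shows "matrix_inv (B ** C) = matrix_inv C ** matrix_inv B"
  using SL2_mult[OF assms] assms
  by (simp add: matrix_inv_SL2 vec_eq_iff forall_2 matrix_matrix_mult_2 algebra_simps)

text \<open>Inversion permutes the entries up to sign, which the Frobenius norm does not see. One
  growth bound therefore serves both directions of time.\<close>

lemma norm_matrix_inv_SL2: "B \<in> SL2 \<Longrightarrow> norm (matrix_inv B) = norm B"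
  by (rule power2_eq_imp_eq) (simp_all add: power2_norm_mat2 matrix_inv_SL2)

lemma matrix_inv_SL2_cancel:
  assumes "B \<in> SL2"
  shows "matrix_inv B *v (B *v x) = x" "B *v (matrix_inv B *v x) = x"
  by (simp_all add: assms matrix_vector_mul_assoc matrix_inv_SL2_left matrix_inv_SL2_right)

lemma norm_le_SL2:
  assumes "B \<in> SL2"
  shows "norm x \<le> norm B * norm (B *v x)"
  using norm_matrix_vector_mult_le[of "matrix_inv B" "B *v x"]
  by (simp add: assms matrix_inv_SL2_cancel norm_matrix_inv_SL2)

lemma norm_SL2_ge_1:
  assumes "B \<in> SL2"
  shows "1 \<le> norm B"
proof (rule power2_le_imp_le)
  have "(norm B)\<^sup>2 = 2 + ((B$1$1 - B$2$2)\<^sup>2 + (B$1$2 + B$2$1)\<^sup>2)"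
    using assms unfolding power2_norm_mat2 SL2_def det_2
    by (simp add: power2_eq_square algebra_simps)
  then show "1\<^sup>2 \<le> (norm B)\<^sup>2"
    by (smt (verit) one_power2 sum_power2_ge_zero)
qed simp

text \<open>Singular vectors are avoided: turning the longer row \<open>r\<close> by a right angle
  gives a vector \<open>p\<close> whose image has norm \<open>\<bar>det B\<bar>\<close>, that is 1.
  Since \<open>norm r\<close> is at least half of \<open>norm B\<close>, normalising
  \<open>p\<close> costs the factor 2.\<close>

lemma SL2_contracted_direction:
  assumes "B \<in> SL2"
  obtains s where "norm s = 1" "norm B * norm (B *v s) \<le> 2"
proof -
  define r where "r = (if norm (B$1) \<ge> norm (B$2) then B$1 else B$2)"
  have det: "B$1$1 * B$2$2 - B$1$2 * B$2$1 = 1"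
    using assms by (simp add: SL2_def det_2)
  have "(norm B)\<^sup>2 = (norm (B$1))\<^sup>2 + (norm (B$2))\<^sup>2"
    by (simp add: power2_norm_mat2 power2_norm_vec2)
  also have "\<dots> \<le> (norm r)\<^sup>2 + (norm r)\<^sup>2"
    by (intro add_mono power_mono) (auto simp: r_def)
  also have "\<dots> \<le> (2 * norm r)\<^sup>2"
    by simp
  finally have Br: "norm B \<le> 2 * norm r"
    by (rule power2_le_imp_le) simp
  then have r0: "norm r > 0"
    using norm_SL2_ge_1[OF assms] by linarith
  define p :: "real^2" where "p = vector [- r$2, r$1]"
  have pr: "norm p = norm r"
    by (rule power2_eq_imp_eq) (simp_all add: power2_norm_vec2 p_def)
  have "(norm (B *v p))\<^sup>2 = 1"
  proof (cases "norm (B$1) \<ge> norm (B$2)")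
    case True
    then have "(B *v p)$1 = 0" "(B *v p)$2 = 1"
      using det by (simp_all add: r_def p_def matrix_vector_mult_2 algebra_simps)
    then show ?thesis
      by (simp add: power2_norm_vec2)
  next
    case False
    then have "(B *v p)$1 = - 1" "(B *v p)$2 = 0"
      using det by (simp_all add: r_def p_def matrix_vector_mult_2 algebra_simps)
    then show ?thesis
      by (simp add: power2_norm_vec2)
  qed
  then have Bp: "norm (B *v p) = 1"
    by (metis norm_ge_zero power2_eq_imp_eq one_power2 zero_le_one)
  show thesis
  proof
    show "norm (inverse (norm r) *\<^sub>R p) = 1"
      using pr r0 by simp
    show "norm B * norm (B *v (inverse (norm r) *\<^sub>R p)) \<le> 2"
      using Br Bp r0 by (simp add: matrix_vector_mult_scaleR field_simps)
  qed
qed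

lemma lines_unit_vector:
  assumes "L \<in> lines"
  obtains w where "w \<in> L" "norm w = 1"
proof -
  obtain \<theta> where "L = line_at_angle \<theta>"
    using assms line_at_angle_surj by blast
  moreover have "norm (vector [cos \<theta>, sin \<theta>] :: real^2) = 1"
    by (intro power2_eq_imp_eq[of _ 1]) (simp_all add: power2_norm_vec2)
  ultimately show thesis
    by (intro that[of "vector [cos \<theta>, sin \<theta>]"]) (simp_all add: line_at_angle_def span_base)
qed

section \<open>Exponentially growing matrix sequences\<close>

text \<open>One forward orbit in isolation. \<open>M\<close>, \<open>c\<close> and
  \<open>\<rho>\<close> are parameters so that bounds depending on them alone hold for all orbits at
  once. The bound 2 at time 0 covers the identity, of Frobenius norm \<open>sqrt 2\<close>.\<close>

locale growing_SL2_sequence =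
  fixes B :: "nat \<Rightarrow> real^2^2" and M c \<rho> :: real
  assumes SL2: "B n \<in> SL2"
    and norm_B_0_le: "norm (B 0) \<le> 2"
    and step: "\<exists>C\<in>SL2. norm C \<le> M \<and> B (Suc n) = C ** B n"
    and c_pos: "0 < c"
    and \<rho>_gt_1: "1 < \<rho>"
    and growth: "c * \<rho> ^ n \<le> norm (B n)"
begin

lemma norm_B_pos: "0 < norm (B n)"
  using norm_SL2_ge_1[OF SL2[of n]] by linarith

lemma M_ge_1: "1 \<le> M"
  using step norm_SL2_ge_1 by (meson order_trans)

lemma norm_B_Suc_le: "norm (B (Suc n)) \<le> M * norm (B n)"
proof -
  obtain C where C: "norm C \<le> M" "B (Suc n) = C ** B n"
    using step by blast
  have "norm (C ** B n) \<le> norm C * norm (B n)"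
    by (rule norm_matrix_mult_le)
  also have "\<dots> \<le> M * norm (B n)"
    using C by (intro mult_right_mono) auto
  finally show ?thesis
    by (simp add: C)
qed

lemma norm_B_le_Suc: "norm (B n) \<le> M * norm (B (Suc n))"
proof -
  obtain C where C: "C \<in> SL2" "norm C \<le> M" "B (Suc n) = C ** B n"
    using step by blast
  then have "B n = matrix_inv C ** B (Suc n)"
    by (simp add: matrix_mul_assoc matrix_inv_SL2_left)
  then have "norm (B n) \<le> norm C * norm (B (Suc n))"
    using norm_matrix_mult_le[of "matrix_inv C" "B (Suc n)"] C by (simp add: norm_matrix_inv_SL2)
  also have "\<dots> \<le> M * norm (B (Suc n))"
    using C by (intro mult_right_mono) auto
  finally show ?thesis .
qed

lemma norm_B_vec_le_Suc: "norm (B n *v x) \<le> M * norm (B (Suc n) *v x)"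
proof -
  obtain C where C: "C \<in> SL2" "norm C \<le> M" "B (Suc n) = C ** B n"
    using step by blast
  have "norm (B n *v x) \<le> norm C * norm (C *v (B n *v x))"
    using C by (intro norm_le_SL2)
  also have "\<dots> \<le> M * norm (B (Suc n) *v x)"
    using C by (simp add: matrix_vector_mul_assoc mult_right_mono)
  finally show ?thesis .
qed

lemma norm_B_le_power: "norm (B n) \<le> 2 * M ^ n"
proof (induction n)
  case (Suc n)
  have "norm (B (Suc n)) \<le> M * norm (B n)"
    by (rule norm_B_Suc_le)
  also have "\<dots> \<le> M * (2 * M ^ n)"
    using Suc M_ge_1 by (intro mult_left_mono) auto
  finally show ?case
    by simp
qed (use norm_B_0_le in simp)

section \<open>Contracted directions and their limit, the line of slow vectors\<close>

definition slow :: "(real^2) set" where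
  "slow = {w. (\<lambda>n. norm (B n *v w) / norm (B n)) \<longlonglongrightarrow> 0}"

definition contracted :: "nat \<Rightarrow> real^2" where
  "contracted n = (SOME s. norm s = 1 \<and> norm (B n) * norm (B n *v s) \<le> 2)"

lemma contracted:
  shows norm_contracted: "norm (contracted n) = 1"
    and norm_B_contracted_le: "norm (B n *v contracted n) \<le> 2 / norm (B n)"
proof -
  have "\<exists>s. norm s = 1 \<and> norm (B n) * norm (B n *v s) \<le> 2"
    using SL2_contracted_direction[OF SL2] by metis
  then have "norm (contracted n) = 1 \<and> norm (B n) * norm (B n *v contracted n) \<le> 2"
    unfolding contracted_def by (rule someI_ex)
  then show "norm (contracted n) = 1" "norm (B n *v contracted n) \<le> 2 / norm (B n)"
    using norm_B_pos[of n] by (auto simp: field_simps)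
qed

text \<open>\<open>B n\<close> contracts both vectors strongly: the second one is contracted by
  \<open>B (Suc n)\<close>, and undoing one step costs a factor \<open>M\<close> for the vector and
  another for the matrix norm. A unimodular matrix can do this only to nearly parallel
  vectors.\<close>

lemma wedge_contracted_Suc_le:
  "\<bar>wedge (contracted n) (contracted (Suc n))\<bar> \<le> 4 * M\<^sup>2 / (norm (B n))\<^sup>2"
proof -
  have "norm (B n *v contracted (Suc n)) \<le> M * norm (B (Suc n) *v contracted (Suc n))"
    by (rule norm_B_vec_le_Suc)
  also have "\<dots> \<le> M * (2 / norm (B (Suc n)))"
    using M_ge_1 by (intro mult_left_mono norm_B_contracted_le) auto
  also have "\<dots> \<le> M * (2 * M / norm (B n))"
    using M_ge_1 norm_B_pos[of n] norm_B_pos[of "Suc n"] norm_B_le_Suc[of n]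
    by (intro mult_left_mono) (auto simp: field_simps)
  finally have "norm (B n *v contracted n) * norm (B n *v contracted (Suc n))
      \<le> (2 / norm (B n)) * (M * (2 * M / norm (B n)))"
    using norm_B_contracted_le by (intro mult_mono) auto
  then show ?thesis
    using abs_wedge_le_SL2[OF SL2[of n], of "contracted n" "contracted (Suc n)"]
    by (simp add: power2_eq_square)
qed

text \<open>The one-step angles are summed against a geometric series of ratio
  \<open>1 / \<mu>\<^sup>2\<close>. Growth is assumed only from time \<open>n\<close> on, so that
  \<open>b\<close> can be the global bound \<open>c * \<rho> ^ n\<close> or, at well-chosen times,
  \<open>norm (B n)\<close> itself.\<close>

lemma wedge_contracted_le:
  assumes "1 < \<mu>" "0 < b" "\<And>j. b * \<mu> ^ j \<le> norm (B (n + j))"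
  shows "\<bar>wedge (contracted n) (contracted (n + k))\<bar> \<le> 4 * M\<^sup>2 / (1 - 1 / \<mu>\<^sup>2) / b\<^sup>2"
proof -
  define q where "q = 1 / \<mu>\<^sup>2"
  have q: "0 < q" "q < 1"
    using assms(1) by (auto simp: q_def power_gt1 less_1_mult power2_eq_square)
  have "\<bar>wedge (contracted n) (contracted (n + k))\<bar> \<le> (\<Sum>j<k. 4 * M\<^sup>2 / b\<^sup>2 * q ^ j)"
  proof (induction k)
    case 0
    show ?case by (simp add: wedge_def)
  next
    case (Suc k)
    have "\<bar>wedge (contracted n) (contracted (n + Suc k))\<bar>
        \<le> \<bar>wedge (contracted n) (contracted (n + k))\<bar>
          + \<bar>wedge (contracted (n + k)) (contracted (Suc (n + k)))\<bar>"
      using wedge_triangle norm_contracted by simp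
    also have "\<dots> \<le> (\<Sum>j<k. 4 * M\<^sup>2 / b\<^sup>2 * q ^ j) + 4 * M\<^sup>2 / (norm (B (n + k)))\<^sup>2"
      using Suc wedge_contracted_Suc_le[of "n + k"] by simp
    also have "4 * M\<^sup>2 / (norm (B (n + k)))\<^sup>2 \<le> 4 * M\<^sup>2 / (b * \<mu> ^ k)\<^sup>2"
      using assms norm_B_pos[of "n + k"] by (intro divide_left_mono power_mono mult_pos_pos) auto
    also have "\<dots> = 4 * M\<^sup>2 / b\<^sup>2 * q ^ k"
      by (simp add: q_def power_mult_distrib power_divide flip: power_mult) (simp add: mult.commute)
    finally show ?case
      by simp
  qed
  also have "\<dots> = 4 * M\<^sup>2 / b\<^sup>2 * (\<Sum>j<k. q ^ j)"
    by (simp add: sum_distrib_left)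
  also have "\<dots> \<le> 4 * M\<^sup>2 / b\<^sup>2 * (1 / (1 - q))"
    using q by (intro mult_left_mono) (auto simp: sum_gp_strict divide_simps)
  also have "\<dots> = 4 * M\<^sup>2 / (1 - q) / b\<^sup>2"
    by simp
  finally show ?thesis
    by (simp add: q_def)
qed

text \<open>Compare both vectors with \<open>contracted (n + k)\<close> and let \<open>k\<close>
  tend to infinity: the angle from there to \<open>w\<close> is at most twice the quotient that
  tends to 0 for slow \<open>w\<close>.\<close>

lemma slow_wedge_contracted_le:
  assumes "w \<in> slow" "norm w = 1" "1 < \<mu>" "0 < b" "\<And>j. b * \<mu> ^ j \<le> norm (B (n + j))"
  shows "\<bar>wedge (contracted n) w\<bar> \<le> 4 * M\<^sup>2 / (1 - 1 / \<mu>\<^sup>2) / b\<^sup>2" (is "_ \<le> ?K")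
proof -
  have lim: "(\<lambda>k. ?K + 2 * (norm (B (k + n) *v w) / norm (B (k + n)))) \<longlonglongrightarrow> ?K + 2 * 0"
    using assms(1) unfolding slow_def
    by (intro tendsto_intros LIMSEQ_ignore_initial_segment[of "\<lambda>k. norm (B k *v w) / norm (B k)"]) simp
  have "\<bar>wedge (contracted n) w\<bar> \<le> ?K + 2 * (norm (B (k + n) *v w) / norm (B (k + n)))" for k
  proof -
    have "\<bar>wedge (contracted n) w\<bar>
        \<le> \<bar>wedge (contracted n) (contracted (n + k))\<bar> + \<bar>wedge (contracted (n + k)) w\<bar>"
      using wedge_triangle norm_contracted assms(2) by blast
    also have "\<dots> \<le> ?K + norm (B (n + k) *v contracted (n + k)) * norm (B (n + k) *v w)"
      using assms by (intro add_mono wedge_contracted_le abs_wedge_le_SL2 SL2) auto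
    also have "norm (B (n + k) *v contracted (n + k)) * norm (B (n + k) *v w)
        \<le> 2 / norm (B (n + k)) * norm (B (n + k) *v w)"
      by (intro mult_right_mono norm_B_contracted_le) auto
    finally show ?thesis
      by (simp add: add.commute)
  qed
  then show ?thesis
    using LIMSEQ_le_const[OF lim] by simp
qed

lemma subspace_slow: "subspace slow"
proof (rule subspaceI)
  show "0 \<in> slow"
    by (simp add: slow_def)
  fix x y assume xy: "x \<in> slow" "y \<in> slow"
  have "(\<lambda>n. norm (B n *v (x + y)) / norm (B n)) \<longlonglongrightarrow> 0"
  proof (rule Lim_null_comparison)
    show "\<forall>\<^sub>F n in sequentially. norm (norm (B n *v (x + y)) / norm (B n))
        \<le> norm (B n *v x) / norm (B n) + norm (B n *v y) / norm (B n)"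
      by (intro always_eventually allI)
        (simp add: matrix_vector_right_distrib divide_right_mono norm_triangle_ineq
          flip: add_divide_distrib)
    show "(\<lambda>n. norm (B n *v x) / norm (B n) + norm (B n *v y) / norm (B n)) \<longlonglongrightarrow> 0"
      using tendsto_add[of _ 0 _ _ 0] xy by (simp add: slow_def)
  qed
  then show "x + y \<in> slow"
    by (simp add: slow_def)
next
  fix r x assume "x \<in> slow"
  then have "(\<lambda>n. \<bar>r\<bar> * (norm (B n *v x) / norm (B n))) \<longlonglongrightarrow> \<bar>r\<bar> * 0"
    unfolding slow_def by (intro tendsto_intros) simp
  then show "r *\<^sub>R x \<in> slow"
    by (simp add: slow_def matrix_vector_mult_scaleR)
qed

text \<open>The images of the two basis vectors together dominate \<open>norm (B n)\<close>, so
  their quotients cannot both tend to 0.\<close>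

lemma slow_neq_UNIV: "slow \<noteq> UNIV"
proof
  let ?f = "\<lambda>x n. norm (B n *v x) / norm (B n)"
  assume "slow = UNIV"
  then have "?f x \<longlonglongrightarrow> 0" for x
    unfolding slow_def by blast
  then have "(\<lambda>n. ?f (axis 1 1) n + ?f (axis 2 1) n) \<longlonglongrightarrow> 0 + 0"
    by (intro tendsto_add)
  moreover have "1 \<le> ?f (axis 1 1) n + ?f (axis 2 1) n" for n
    using norm_mat2_le_sum[of "B n"] norm_B_pos[of n] by (simp add: field_simps)
  ultimately have "(1::real) \<le> 0 + 0"
    by (intro LIMSEQ_le_const) auto
  then show False
    by simp
qed

text \<open>The vectors \<open>contracted n\<close> may keep changing sign, so \<open>w\<close> is
  taken as the limit of a subsequence on the circle. The tail estimate is insensitive to signs and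
  bounds the angle to \<open>w\<close> at every time, not only along the subsequence.\<close>

lemma slow_unit_vector: "\<exists>w\<in>slow. norm w = 1"
proof -
  have "compact (sphere (0::real^2) 1)" "\<forall>n. contracted n \<in> sphere 0 1"
    by (simp_all add: norm_contracted)
  then obtain w r where w: "w \<in> sphere 0 1" "strict_mono r" "(contracted \<circ> r) \<longlonglongrightarrow> w"
    unfolding compact_def by blast
  have norm_w: "norm w = 1"
    using w(1) by simp
  let ?K = "4 * M\<^sup>2 / (1 - 1 / \<rho>\<^sup>2)"
  have wedge_le: "\<bar>wedge (contracted n) w\<bar> \<le> ?K / (c * \<rho> ^ n)\<^sup>2" for n
  proof (rule LIMSEQ_le_const2)
    show "(\<lambda>k. \<bar>wedge (contracted n) ((contracted \<circ> r) k)\<bar>) \<longlonglongrightarrow> \<bar>wedge (contracted n) w\<bar>"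
      unfolding wedge_def by (intro tendsto_intros w(3))
    have "\<bar>wedge (contracted n) ((contracted \<circ> r) k)\<bar> \<le> ?K / (c * \<rho> ^ n)\<^sup>2" if "n \<le> k" for k
    proof -
      have "r k = n + (r k - n)"
        using seq_suble[OF w(2), of k] that by simp
      moreover have "\<bar>wedge (contracted n) (contracted (n + (r k - n)))\<bar> \<le> ?K / (c * \<rho> ^ n)\<^sup>2"
        using growth[of "n + j" for j] c_pos \<rho>_gt_1
        by (intro wedge_contracted_le) (simp_all add: power_add mult.assoc)
      ultimately show ?thesis
        by simp
    qed
    then show "\<exists>N. \<forall>k\<ge>N. \<bar>wedge (contracted n) ((contracted \<circ> r) k)\<bar> \<le> ?K / (c * \<rho> ^ n)\<^sup>2"
      by blast
  qed
  have "(\<lambda>n. norm (B n *v w) / norm (B n)) \<longlonglongrightarrow> 0"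
  proof (rule Lim_null_comparison)
    show "\<forall>\<^sub>F n in sequentially. norm (norm (B n *v w) / norm (B n))
        \<le> 2 / (c * \<rho> ^ n)\<^sup>2 + ?K / (c * \<rho> ^ n)\<^sup>2"
    proof (intro always_eventually allI)
      fix n
      have "norm (B n *v w) \<le> norm (B n *v contracted n) + norm (B n) * \<bar>wedge (contracted n) w\<bar>"
        using norm_contracted norm_w by (rule norm_matrix_mult_wedge_le)
      also have "\<dots> \<le> 2 / norm (B n) + norm (B n) * (?K / (c * \<rho> ^ n)\<^sup>2)"
        by (intro add_mono mult_left_mono norm_B_contracted_le wedge_le) auto
      finally have "norm (B n *v w) / norm (B n)
          \<le> (2 / norm (B n) + norm (B n) * (?K / (c * \<rho> ^ n)\<^sup>2)) / norm (B n)"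
        by (intro divide_right_mono) auto
      also have "\<dots> = 2 / (norm (B n))\<^sup>2 + ?K / (c * \<rho> ^ n)\<^sup>2"
        using norm_B_pos[of n] by (simp add: add_divide_distrib power2_eq_square)
      also have "2 / (norm (B n))\<^sup>2 \<le> 2 / (c * \<rho> ^ n)\<^sup>2"
        using c_pos \<rho>_gt_1 growth[of n] norm_B_pos[of n]
        by (intro divide_left_mono power_mono mult_pos_pos) auto
      finally show "norm (norm (B n *v w) / norm (B n)) \<le> 2 / (c * \<rho> ^ n)\<^sup>2 + ?K / (c * \<rho> ^ n)\<^sup>2"
        by simp
    qed
    have "(\<lambda>n. (2 + ?K) / c\<^sup>2 * (1 / \<rho>\<^sup>2) ^ n) \<longlonglongrightarrow> (2 + ?K) / c\<^sup>2 * 0"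
      using \<rho>_gt_1 by (intro tendsto_mult_left LIMSEQ_power_zero) (simp add: one_less_power)
    moreover have "(2 + k) / c\<^sup>2 * (1 / \<rho>\<^sup>2) ^ n = 2 / (c * \<rho> ^ n)\<^sup>2 + k / (c * \<rho> ^ n)\<^sup>2" for k n
      by (simp add: power_mult_distrib power_divide add_divide_distrib mult.commute[of n] flip: power_mult)
    ultimately show "(\<lambda>n. 2 / (c * \<rho> ^ n)\<^sup>2 + ?K / (c * \<rho> ^ n)\<^sup>2) \<longlonglongrightarrow> 0"
      by simp
  qed
  then show ?thesis
    using norm_w by (auto simp: slow_def)
qed

lemma slow_in_lines: "slow \<in> lines"
proof -
  have "dim slow \<noteq> 0"
    using slow_unit_vector by (auto simp del: vec.dim_eq_0)
  moreover have "dim slow \<noteq> 2"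
    using slow_neq_UNIV dim_eq_full[of slow] span_eq_iff[THEN iffD2, OF subspace_slow] by simp
  moreover have "dim slow \<le> 2"
    using dim_subset_UNIV[of slow] by simp
  ultimately have "dim slow = 1"
    by linarith
  then show ?thesis
    using subspace_slow by (simp add: lines_def)
qed

end

section \<open>A contraction time that is uniform over all orbits\<close>

lemma exists_future_minimal_rate:
  fixes a :: "nat \<Rightarrow> real"
  assumes "0 < \<mu>" "N \<le> N'" "\<And>k. N' < k \<Longrightarrow> a N / \<mu> ^ N \<le> a k / \<mu> ^ k"
  shows "\<exists>n\<in>{N..N'}. \<forall>j. a n * \<mu> ^ j \<le> a (n + j)"
proof -
  define b where "b k = a k / \<mu> ^ k" for k
  \<comment> \<open>A minimum over the window is a minimum over all later indices as well, because
    beyond \<open>N'\<close> no value drops below \<open>b N\<close>.\<close>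
  obtain n where n: "is_arg_min b (\<lambda>k. k \<in> {N..N'}) n"
    using ex_is_arg_min_if_finite[of "{N..N'}" b] assms(2) by auto
  then have n': "n \<in> {N..N'}" "\<And>k. k \<in> {N..N'} \<Longrightarrow> b n \<le> b k"
    by (auto simp: is_arg_min_linorder)
  have "b n \<le> b (n + j)" for j
  proof (cases "n + j \<le> N'")
    case True
    then show ?thesis
      using n' by simp
  next
    case False
    then have "b N \<le> b (n + j)"
      using assms(3) by (simp add: b_def)
    moreover have "b n \<le> b N"
      using n' assms(2) by simp
    ultimately show ?thesis
      by simp
  qed
  then have "a n * \<mu> ^ j \<le> a (n + j)" for j
    using assms(1) by (auto simp: b_def power_add field_simps)
  then show ?thesis
    using n'(1) by blast
qed

text \<open>The order of quantifiers is the point: \<open>N'\<close> is found from \<open>M\<close>,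
  \<open>c\<close> and \<open>\<rho>\<close>, before the sequence and the vector are given.\<close>

lemma uniform_contraction_time:
  assumes "0 < c" "1 < \<rho>"
  obtains N' :: nat where "1 \<le> N'"
    "\<And>B w. growing_SL2_sequence B M c \<rho> \<Longrightarrow> w \<in> growing_SL2_sequence.slow B \<Longrightarrow> norm w = 1
      \<Longrightarrow> \<exists>n\<in>{1..N'}. norm (B n *v w) \<le> 1/2"
proof -
  \<comment> \<open>A rate between 1 and \<open>\<rho>\<close>: above 1 the tail sums converge, and
    below \<open>\<rho>\<close> the quotients \<open>norm (B k) / \<mu> ^ k\<close> tend to
    infinity.\<close>
  define \<mu> where "\<mu> = sqrt \<rho>"
  have \<mu>: "1 < \<mu>" "\<mu>\<^sup>2 = \<rho>"
    using assms by (auto simp: \<mu>_def)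
  define K where "K = 2 + 4 * M\<^sup>2 / (1 - 1 / \<mu>\<^sup>2)"
  obtain N0 where N0: "2 * K / c < \<rho> ^ N0"
    using real_arch_pow[OF assms(2)] by blast
  \<comment> \<open>The maximum with 1 excludes time 0, at which the later induction would make no
    progress.\<close>
  define N where "N = max 1 N0"
  have "2 * K / c < \<rho> ^ N"
    using N0 power_increasing[of N0 N \<rho>] assms(2) by (simp add: N_def del: power_increasing_iff)
  then have N: "1 \<le> N" "K / (c * \<rho> ^ N) \<le> 1/2"
    using assms by (auto simp: N_def field_simps)
  \<comment> \<open>\<open>2 * M ^ N\<close> bounds \<open>norm (B N)\<close> for every admissible
    sequence; beyond \<open>N1\<close> the quotients, being at least \<open>c * \<mu> ^ k\<close>,
    exceed it.\<close>
  obtain N1 where N1: "2 * M ^ N / c < \<mu> ^ N1"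
    using real_arch_pow[OF \<mu>(1)] by blast
  define N' where "N' = max N N1"
  have "\<exists>n\<in>{1..N'}. norm (B n *v w) \<le> 1/2"
    if "growing_SL2_sequence B M c \<rho>" and w: "w \<in> growing_SL2_sequence.slow B" "norm w = 1"
    for B w
  proof -
    interpret growing_SL2_sequence B M c \<rho>
      by fact
    have "norm (B N) / \<mu> ^ N \<le> norm (B k) / \<mu> ^ k" if "N' < k" for k
    proof -
      have "norm (B N) / \<mu> ^ N \<le> 2 * M ^ N / 1"
        using norm_B_le_power[of N] \<mu> M_ge_1 by (intro frac_le) auto
      also have "\<dots> \<le> c * \<mu> ^ N1"
        using N1 assms by (simp add: field_simps)
      also have "\<dots> \<le> c * \<mu> ^ k"
        using that \<mu> assms by (intro mult_left_mono power_increasing) (auto simp: N'_def)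
      also have "\<dots> = c * \<rho> ^ k / \<mu> ^ k"
        using \<mu>(1) by (simp add: \<mu>(2)[symmetric] field_simps flip: power_mult power_add)
      also have "\<dots> \<le> norm (B k) / \<mu> ^ k"
        using growth \<mu> by (intro divide_right_mono) auto
      finally show ?thesis .
    qed
    then obtain n where n: "n \<in> {N..N'}" "\<And>j. norm (B n) * \<mu> ^ j \<le> norm (B (n + j))"
      using exists_future_minimal_rate[of \<mu> N N' "\<lambda>k. norm (B k)"] \<mu>(1) by (auto simp: N'_def)
    \<comment> \<open>At this \<open>n\<close> the tail estimate holds with
      \<open>b = norm (B n)\<close>. The image of \<open>contracted n\<close> and the angle term are
      then both of order \<open>1 / norm (B n)\<close>, and \<open>K\<close> collects their
      constants.\<close>
    have "norm (B n *v w) \<le> norm (B n *v contracted n) + norm (B n) * \<bar>wedge (contracted n) w\<bar>"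
      using norm_contracted w(2) by (rule norm_matrix_mult_wedge_le)
    also have "\<dots> \<le> 2 / norm (B n) + norm (B n) * (4 * M\<^sup>2 / (1 - 1 / \<mu>\<^sup>2) / (norm (B n))\<^sup>2)"
      using n(2) \<mu>(1) w norm_B_pos
      by (intro add_mono mult_left_mono norm_B_contracted_le slow_wedge_contracted_le) auto
    also have "\<dots> = K / norm (B n)"
      using norm_B_pos[of n] by (simp add: K_def power2_eq_square add_divide_distrib)
    also have "\<dots> \<le> K / (c * \<rho> ^ N)"
    proof (rule divide_left_mono)
      have "c * \<rho> ^ N \<le> c * \<rho> ^ n"
        using n(1) assms by (intro mult_left_mono power_increasing) auto
      then show "c * \<rho> ^ N \<le> norm (B n)"
        using growth[of n] by simp
      show "0 \<le> K"
        using \<mu>(1) by (auto simp: K_def intro!: add_nonneg_nonneg divide_nonneg_nonneg)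
      show "0 < norm (B n) * (c * \<rho> ^ N)"
        using assms norm_B_pos by simp
    qed
    also have "\<dots> \<le> 1/2"
      by (rule N)
    finally show ?thesis
      using n(1) N(1) by auto
  qed
  moreover have "1 \<le> N'"
    using N by (simp add: N'_def)
  ultimately show thesis
    using that by blast
qed

section \<open>Stable directions of a growing cocycle\<close>

lemma forward_cocycle_add:
  "forward_cocycle T A (m + n) \<omega> = forward_cocycle T A n ((T ^^ m) \<omega>) ** forward_cocycle T A m \<omega>"
  by (induction n) (simp_all add: matrix_mul_assoc funpow_add add.commute[of m] flip: funpow_swap1)

lemma forward_cocycle_Suc_right:
  "forward_cocycle T A (Suc n) \<omega> = forward_cocycle T A n (T \<omega>) ** A \<omega>"
  using forward_cocycle_add[of T A 1 n \<omega>] by simp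

lemma funpow_in: "T \<in> \<Omega> \<rightarrow> \<Omega> \<Longrightarrow> \<omega> \<in> \<Omega> \<Longrightarrow> (T ^^ n) \<omega> \<in> \<Omega>"
  by (induction n) auto

lemma forward_cocycle_SL2:
  assumes "T \<in> \<Omega> \<rightarrow> \<Omega>" "A \<in> \<Omega> \<rightarrow> SL2" "\<omega> \<in> \<Omega>"
  shows "forward_cocycle T A n \<omega> \<in> SL2"
proof (induction n)
  case 0
  show ?case by (simp add: SL2_def)
next
  case (Suc n)
  then show ?case
    using funpow_in[of T \<Omega> \<omega> n] assms by (auto intro: SL2_mult)
qed

text \<open>Applied in both directions, this makes slowness independent of a bounded change of the
  normalising factor.\<close>

lemma tendsto_0_change_denominator:
  fixes f p q :: "nat \<Rightarrow> real"
  assumes "(\<lambda>n. f n / q n) \<longlonglongrightarrow> 0" "\<And>n. 0 \<le> f n" "\<And>n. 0 < p n" "\<And>n. 0 < q n" "\<And>n. q n \<le> M * p n"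
  shows "(\<lambda>n. f n / p n) \<longlonglongrightarrow> 0"
proof (rule Lim_null_comparison)
  have "f n * q n \<le> f n * (M * p n)" for n
    using assms by (intro mult_left_mono) auto
  then have "f n / p n \<le> M * (f n / q n)" for n
    using assms(3,4)[of n] by (simp add: field_simps)
  then show "\<forall>\<^sub>F n in sequentially. norm (f n / p n) \<le> M * (f n / q n)"
    using assms(2) less_imp_le[OF assms(3)] by (intro always_eventually) auto
  show "(\<lambda>n. M * (f n / q n)) \<longlonglongrightarrow> 0"
    using tendsto_mult_left[OF assms(1), of M] by simp
qed

text \<open>The stable line at a point is the slow line of its forward orbit. Only forward iterates
  occur, so the statement applies to the inverse cocycle too and there yields the unstable
  directions.\<close>

lemma stable_directions_exist:
  fixes M :: real
  assumes T: "T \<in> \<Omega> \<rightarrow> \<Omega>" and A: "A \<in> \<Omega> \<rightarrow> SL2"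
    and bounded: "\<And>\<omega>. \<omega> \<in> \<Omega> \<Longrightarrow> norm (A \<omega>) \<le> M"
    and c: "0 < c" and \<rho>: "1 < \<rho>"
    and growth: "\<And>n \<omega>. 1 \<le> n \<Longrightarrow> \<omega> \<in> \<Omega> \<Longrightarrow> c * \<rho> ^ n \<le> norm (forward_cocycle T A n \<omega>)"
  obtains s C \<kappa> where "s \<in> \<Omega> \<rightarrow> lines"
    "\<And>\<omega>. \<omega> \<in> \<Omega> \<Longrightarrow> projective_action (A \<omega>) (s \<omega>) = s (T \<omega>)"
    "0 < C" "1 < \<kappa>"
    "\<And>n \<omega> w. \<omega> \<in> \<Omega> \<Longrightarrow> w \<in> s \<omega> \<Longrightarrow> norm w = 1 \<Longrightarrow> norm (forward_cocycle T A n \<omega> *v w) \<le> C / \<kappa> ^ n"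
proof -
  define B where "B \<omega> n = forward_cocycle T A n \<omega>" for \<omega> n
  \<comment> \<open>Growth is given from time 1 on; capping the constant at 1 extends it to time 0.
    Likewise \<open>M'\<close> is at least 1 even if \<open>\<Omega>\<close> is empty.\<close>
  define c' where "c' = min c 1"
  define M' where "M' = max 1 M"
  have c': "0 < c'" and M': "1 \<le> M'"
    using c by (simp_all add: c'_def M'_def)
  have A_SL2: "A \<omega> \<in> SL2" if "\<omega> \<in> \<Omega>" for \<omega>
    using A that by blast
  have B_SL2: "B \<omega> n \<in> SL2" if "\<omega> \<in> \<Omega>" for \<omega> n
    unfolding B_def using T A that by (rule forward_cocycle_SL2)
  have G: "growing_SL2_sequence (B \<omega>) M' c' \<rho>" if \<omega>: "\<omega> \<in> \<Omega>" for \<omega>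
  proof
    show "B \<omega> n \<in> SL2" for n
      using \<omega> by (rule B_SL2)
    show "norm (B \<omega> 0) \<le> 2"
      by (rule power2_le_imp_le) (simp_all add: B_def power2_norm_mat2 mat_def)
    show "\<exists>C\<in>SL2. norm C \<le> M' \<and> B \<omega> (Suc n) = C ** B \<omega> n" for n
      using funpow_in[OF T \<omega>, of n] A bounded
      by (intro bexI[of _ "A ((T ^^ n) \<omega>)"]) (auto simp: B_def M'_def max.coboundedI2)
    show "c' * \<rho> ^ n \<le> norm (B \<omega> n)" for n
    proof (cases "n = 0")
      case True
      then show ?thesis
        using norm_SL2_ge_1[OF B_SL2[OF \<omega>, of 0]] by (simp add: c'_def)
    next
      case False
      have "c' * \<rho> ^ n \<le> c * \<rho> ^ n"
        using \<rho> by (intro mult_right_mono) (auto simp: c'_def)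
      then show ?thesis
        using growth[of n \<omega>] False \<omega> by (simp add: B_def)
    qed
  qed (use c' \<rho> in auto)
  define s where "s \<omega> = growing_SL2_sequence.slow (B \<omega>)" for \<omega>
  have s_iff: "w \<in> s \<omega> \<longleftrightarrow> (\<lambda>n. norm (B \<omega> n *v w) / norm (B \<omega> n)) \<longlonglongrightarrow> 0" if "\<omega> \<in> \<Omega>" for \<omega> w
    unfolding s_def using growing_SL2_sequence.slow_def[OF G[OF that]] by simp
  have s_lines: "s \<omega> \<in> lines" if "\<omega> \<in> \<Omega>" for \<omega>
    unfolding s_def using growing_SL2_sequence.slow_in_lines[OF G[OF that]] .
  \<comment> \<open>After a shift of the index by one, both conditions speak of the same vectors
    \<open>B \<omega> (Suc n) *v w\<close>; their normalising factors differ by at most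
    \<open>M'\<close> either way.\<close>
  have invariant: "A \<omega> *v w \<in> s (T \<omega>) \<longleftrightarrow> w \<in> s \<omega>" if \<omega>: "\<omega> \<in> \<Omega>" for \<omega> w
  proof -
    have T\<omega>: "T \<omega> \<in> \<Omega>"
      using T \<omega> by blast
    let ?f = "\<lambda>n. norm (B \<omega> (Suc n) *v w)"
    let ?p = "\<lambda>n. norm (B (T \<omega>) n)"
    let ?q = "\<lambda>n. norm (B \<omega> (Suc n))"
    have B_Suc: "B \<omega> (Suc n) = B (T \<omega>) n ** A \<omega>" for n
      by (simp add: B_def forward_cocycle_Suc_right del: forward_cocycle.simps)
    then have B_eq: "B (T \<omega>) n = B \<omega> (Suc n) ** matrix_inv (A \<omega>)" for n
      by (simp add: matrix_inv_SL2_right[OF A_SL2[OF \<omega>]] flip: matrix_mul_assoc)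
    have norm_A: "norm (A \<omega>) \<le> M'"
      using bounded[OF \<omega>] by (simp add: M'_def)
    have qp: "?q n \<le> M' * ?p n" for n
    proof -
      have "?q n \<le> ?p n * norm (A \<omega>)"
        unfolding B_Suc by (rule norm_matrix_mult_le)
      also have "\<dots> \<le> ?p n * M'"
        using norm_A by (intro mult_left_mono) auto
      finally show ?thesis
        by (simp add: mult.commute)
    qed
    have pq: "?p n \<le> M' * ?q n" for n
    proof -
      have "?p n \<le> ?q n * norm (matrix_inv (A \<omega>))"
        unfolding B_eq by (rule norm_matrix_mult_le)
      also have "\<dots> \<le> ?q n * M'"
        using norm_A by (intro mult_left_mono) (auto simp: norm_matrix_inv_SL2[OF A_SL2[OF \<omega>]])
      finally show ?thesis
        by (simp add: mult.commute)
    qed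
    have pos: "0 < ?p n" "0 < ?q n" for n
      using growing_SL2_sequence.norm_B_pos[OF G] \<omega> T\<omega> by blast+
    have "A \<omega> *v w \<in> s (T \<omega>) \<longleftrightarrow> (\<lambda>n. ?f n / ?p n) \<longlonglongrightarrow> 0"
      by (simp add: s_iff[OF T\<omega>] B_Suc matrix_vector_mul_assoc)
    also have "\<dots> \<longleftrightarrow> (\<lambda>n. ?f n / ?q n) \<longlonglongrightarrow> 0"
      using tendsto_0_change_denominator[of ?f ?p ?q M'] tendsto_0_change_denominator[of ?f ?q ?p M']
        pos qp pq by auto
    also have "\<dots> \<longleftrightarrow> w \<in> s \<omega>"
      unfolding s_iff[OF \<omega>] by (rule filterlim_sequentially_Suc)
    finally show ?thesis .
  qed
  have invariant_iterate: "B \<omega> m *v w \<in> s ((T ^^ m) \<omega>)" if "\<omega> \<in> \<Omega>" "w \<in> s \<omega>" for \<omega> w m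
  proof (induction m)
    case (Suc m)
    then show ?case
      using invariant[OF funpow_in[OF T that(1)], of m "B \<omega> m *v w"]
      by (simp add: B_def matrix_vector_mul_assoc)
  qed (use that in \<open>simp add: B_def\<close>)
  obtain N where N: "1 \<le> N"
    "\<And>\<omega> w. \<omega> \<in> \<Omega> \<Longrightarrow> w \<in> s \<omega> \<Longrightarrow> norm w = 1 \<Longrightarrow> \<exists>n\<in>{1..N}. norm (B \<omega> n *v w) \<le> 1/2"
    using uniform_contraction_time[OF c' \<rho>, of M'] G unfolding s_def by metis
  \<comment> \<open>Homogeneity removes the normalisation, since the images of a unit vector along
    the orbit are no longer unit vectors.\<close>
  have contraction: "\<exists>n\<in>{1..N}. norm (B \<omega> n *v w) \<le> norm w / 2" if \<omega>: "\<omega> \<in> \<Omega>" and w: "w \<in> s \<omega>" for \<omega> w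
  proof (cases "w = 0")
    case False
    have "subspace (s \<omega>)"
      using s_lines[OF \<omega>] by (simp add: lines_def)
    then have "inverse (norm w) *\<^sub>R w \<in> s \<omega>"
      using w by (rule subspace_scale)
    moreover have "norm (inverse (norm w) *\<^sub>R w) = 1"
      using False by simp
    ultimately obtain n where "n \<in> {1..N}" "norm (B \<omega> n *v (inverse (norm w) *\<^sub>R w)) \<le> 1/2"
      using N(2)[OF \<omega>] by blast
    then show ?thesis
      using False by (intro bexI[of _ n]) (auto simp: matrix_vector_mult_scaleR field_simps)
  qed (use N(1) in auto)
  \<comment> \<open>Halving within at most \<open>N\<close> steps is decay at the rate of the
    \<open>N\<close>-th root of 2, because \<open>\<kappa> ^ m \<le> 2\<close> for
    \<open>m \<le> N\<close>.\<close>
  define \<kappa> where "\<kappa> = root N 2"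
  have \<kappa>: "1 < \<kappa>" "\<kappa> ^ N = 2"
    using N(1) by (simp_all add: \<kappa>_def)
  have \<kappa>_le: "\<kappa> ^ m \<le> 2" if "m \<le> N" for m
    using power_increasing[OF that, of \<kappa>] \<kappa> by simp
  \<comment> \<open>Chosen for the times below \<open>N\<close>, where the matrix norm is at most
    \<open>2 * M' ^ N\<close> and \<open>\<kappa> ^ n\<close> at most 2.\<close>
  define C where "C = 4 * M' ^ N"
  have C: "0 < C"
    using M' by (simp add: C_def)
  have decay: "norm (B \<omega> n *v w) \<le> C / \<kappa> ^ n * norm w" if "\<omega> \<in> \<Omega>" "w \<in> s \<omega>" for \<omega> w n
    using that
  proof (induction n arbitrary: \<omega> w rule: less_induct)
    case (less n)
    show ?case
    proof (cases "n < N")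
      case True
      have "norm (B \<omega> n) \<le> 2 * M' ^ n"
        using growing_SL2_sequence.norm_B_le_power[OF G[OF less.prems(1)]] .
      also have "\<dots> \<le> 2 * M' ^ N"
        using True M' by (intro mult_left_mono power_increasing) auto
      also have "\<dots> \<le> C / \<kappa> ^ n"
        using \<kappa>_le[of n] True \<kappa>(1) M' by (simp add: C_def field_simps)
      finally have "norm (B \<omega> n) * norm w \<le> C / \<kappa> ^ n * norm w"
        by (intro mult_right_mono) auto
      then show ?thesis
        using norm_matrix_vector_mult_le[of "B \<omega> n" w] by linarith
    next
      case False
      \<comment> \<open>Run to the first half-contraction and apply the induction hypothesis at the
        point reached; \<open>m \<ge> 1\<close> leaves fewer than \<open>n\<close> steps, and the
        gained half pays for \<open>\<kappa> ^ m\<close>.\<close>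
      obtain m where m: "m \<in> {1..N}" "norm (B \<omega> m *v w) \<le> norm w / 2"
        using contraction less.prems by blast
      define k where "k = n - m"
      have n: "n = m + k" "k < n"
        using m False by (auto simp: k_def)
      have "B \<omega> n *v w = B ((T ^^ m) \<omega>) k *v (B \<omega> m *v w)"
        unfolding n(1) B_def forward_cocycle_add by (simp add: matrix_vector_mul_assoc)
      also have "norm \<dots> \<le> C / \<kappa> ^ k * norm (B \<omega> m *v w)"
        using less.prems n(2) by (intro less.IH funpow_in[OF T] invariant_iterate)
      also have "\<dots> \<le> C / \<kappa> ^ k * (norm w / 2)"
        using m C \<kappa> by (intro mult_left_mono) auto
      also have "\<dots> \<le> C / \<kappa> ^ k * (norm w / \<kappa> ^ m)"
        using \<kappa>_le[of m] m C \<kappa> by (intro mult_left_mono divide_left_mono) auto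
      also have "\<dots> = C / \<kappa> ^ n * norm w"
        by (simp add: n(1) power_add)
      finally show ?thesis .
    qed
  qed
  show thesis
  proof
    show "s \<in> \<Omega> \<rightarrow> lines"
      using s_lines by blast
    show "projective_action (A \<omega>) (s \<omega>) = s (T \<omega>)" if "\<omega> \<in> \<Omega>" for \<omega>
    proof (intro antisym subsetI)
      fix x assume "x \<in> s (T \<omega>)"
      moreover have x: "x = A \<omega> *v (matrix_inv (A \<omega>) *v x)"
        using A_SL2[OF that] by (simp add: matrix_inv_SL2_cancel)
      ultimately have "matrix_inv (A \<omega>) *v x \<in> s \<omega>"
        using invariant[OF that] by metis
      then show "x \<in> projective_action (A \<omega>) (s \<omega>)"
        using x unfolding projective_action_def by (rule rev_image_eqI)
    qed (use invariant[OF that] in \<open>auto simp: projective_action_def\<close>)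
    show "norm (forward_cocycle T A n \<omega> *v w) \<le> C / \<kappa> ^ n"
      if "\<omega> \<in> \<Omega>" "w \<in> s \<omega>" "norm w = 1" for n \<omega> w
      using decay[OF that(1,2), of n] that(3) by (simp add: B_def)
  qed (fact C \<kappa>)+
qed

section \<open>Continuity and the inverse cocycle\<close>

text \<open>Translates the quotient topology on lines into an estimate on wedges: the wedge of unit
  vectors is the sine of the difference of their angles.\<close>

lemma continuous_map_RP1I:
  assumes lines: "s \<in> topspace X \<rightarrow> lines"
    and near: "\<And>x w e. \<lbrakk>x \<in> topspace X; w \<in> s x; norm w = 1; 0 < e\<rbrakk> \<Longrightarrow>
      \<exists>U. openin X U \<and> x \<in> U \<and> (\<forall>y\<in>U. \<forall>v\<in>s y. norm v = 1 \<longrightarrow> \<bar>wedge v w\<bar> < e)"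
  shows "continuous_map X RP1 s"
proof -
  define dir where "dir \<theta> = (vector [cos \<theta>, sin \<theta>] :: real^2)" for \<theta>
  have dir: "norm (dir \<theta>) = 1" "dir \<theta> \<in> line_at_angle \<theta>" for \<theta>
    unfolding dir_def line_at_angle_def
    by (intro power2_eq_imp_eq[of _ 1]) (simp_all add: power2_norm_vec2 span_base)
  have wedge_dir: "wedge (dir \<phi>) (dir \<theta>) = sin (\<theta> - \<phi>)" for \<phi> \<theta>
    by (simp add: dir_def wedge_def sin_diff)
  have "openin X {x \<in> topspace X. s x \<in> V}" if V: "openin RP1 V" for V
  proof (subst openin_subopen, intro ballI)
    fix x assume "x \<in> {x \<in> topspace X. s x \<in> V}"
    then have x: "x \<in> topspace X" "s x \<in> V"
      by auto
    then obtain \<theta> where \<theta>: "s x = line_at_angle \<theta>"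
      using lines line_at_angle_surj by blast
    have "open {\<theta>. line_at_angle \<theta> \<in> V}" "\<theta> \<in> {\<theta>. line_at_angle \<theta> \<in> V}"
      using V x \<theta> by (auto simp: openin_RP1)
    then obtain d where d: "0 < d" "ball \<theta> d \<subseteq> {\<theta>. line_at_angle \<theta> \<in> V}"
      by (meson openE)
    \<comment> \<open>Up to \<open>pi / 2\<close> the sine is increasing, so a bound on sines
      becomes one on angles.\<close>
    define d' where "d' = min d (pi / 2)"
    have d': "0 < d'" "d' \<le> d" "d' \<le> pi / 2"
      using d(1) by (auto simp: d'_def)
    then have "0 < sin d'"
      using pi_half_gt_zero by (intro sin_gt_zero) linarith+
    then obtain U where U: "openin X U" "x \<in> U"
      "\<And>y v. y \<in> U \<Longrightarrow> v \<in> s y \<Longrightarrow> norm v = 1 \<Longrightarrow> \<bar>wedge v (dir \<theta>)\<bar> < sin d'"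
      using near[OF x(1), of "dir \<theta>" "sin d'"] dir \<theta> by metis
    have "s y \<in> V" if y: "y \<in> U" for y
    proof -
      have "y \<in> topspace X"
        using y U(1) openin_subset by blast
      then obtain \<phi>0 where \<phi>0: "s y = line_at_angle \<phi>0"
        using lines line_at_angle_surj by blast
      \<comment> \<open>Shifting by the nearest multiple of \<open>pi\<close> keeps the line and
        brings its angle within \<open>pi / 2\<close> of \<open>\<theta>\<close>.\<close>
      define k where "k = round ((\<phi>0 - \<theta>) / pi)"
      define \<phi> where "\<phi> = \<phi>0 - of_int k * pi"
      have s_y: "s y = line_at_angle \<phi>"
        unfolding \<phi>0 line_at_angle_eq_iff by (auto simp: \<phi>_def)
      have "\<bar>of_int k - (\<phi>0 - \<theta>) / pi\<bar> \<le> 1/2"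
        unfolding k_def by (rule of_int_round_abs_le)
      then have "\<bar>of_int k - (\<phi>0 - \<theta>) / pi\<bar> * pi \<le> 1/2 * pi"
        by (intro mult_right_mono) auto
      also have "\<bar>of_int k - (\<phi>0 - \<theta>) / pi\<bar> * pi = \<bar>(of_int k - (\<phi>0 - \<theta>) / pi) * pi\<bar>"
        by (simp add: abs_mult)
      also have "(of_int k - (\<phi>0 - \<theta>) / pi) * pi = \<theta> - \<phi>"
        by (simp add: \<phi>_def field_simps)
      finally have t: "\<bar>\<theta> - \<phi>\<bar> \<le> pi / 2"
        by simp
      have "\<bar>sin (\<theta> - \<phi>)\<bar> < sin d'"
        using U(3)[OF y, of "dir \<phi>"] dir s_y by (simp add: wedge_dir)
      moreover have "\<bar>sin (\<theta> - \<phi>)\<bar> = sin \<bar>\<theta> - \<phi>\<bar>"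
        using t sin_ge_zero[of "\<bar>\<theta> - \<phi>\<bar>"] sin_minus[of "\<theta> - \<phi>"] by (auto simp: abs_if)
      ultimately have "\<bar>\<theta> - \<phi>\<bar> < d'"
        using sin_monotone_2pi_le[of d' "\<bar>\<theta> - \<phi>\<bar>"] t d' by (smt (verit))
      then have "\<phi> \<in> ball \<theta> d"
        using d' by (simp add: dist_real_def)
      then show ?thesis
        using d(2) s_y by auto
    qed
    then show "\<exists>U. openin X U \<and> x \<in> U \<and> U \<subseteq> {x \<in> topspace X. s x \<in> V}"
      using U(1,2) openin_subset by blast
  qed
  then show ?thesis
    using lines by (simp add: continuous_map_def topspace_RP1)
qed

text \<open>One large time \<open>n\<close> is fixed. The vector \<open>v\<close> decays uniformly
  in \<open>y\<close>, while \<open>w\<close>, stable at \<open>x\<close>, stays bounded under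
  \<open>B n y\<close> for \<open>y\<close> near \<open>x\<close>; the product of the two norms
  bounds the wedge.\<close>

lemma continuous_map_uniformly_decaying_lines:
  assumes cont: "\<And>n. continuous_map X euclidean (B n)"
    and SL2: "\<And>n x. x \<in> topspace X \<Longrightarrow> B n x \<in> SL2"
    and lines: "s \<in> topspace X \<rightarrow> lines"
    and \<rho>: "1 < \<rho>"
    and decay: "\<And>n x w. \<lbrakk>1 \<le> n; x \<in> topspace X; w \<in> s x; norm w = 1\<rbrakk> \<Longrightarrow> norm (B n x *v w) \<le> C / \<rho> ^ n"
  shows "continuous_map X RP1 s"
proof (rule continuous_map_RP1I[OF lines])
  fix x w and e :: real
  assume x: "x \<in> topspace X" "w \<in> s x" "norm w = 1" and e: "0 < e"
  have "(\<lambda>n. C * (1 / \<rho>) ^ n * (C * (1 / \<rho>) ^ n + 1)) \<longlonglongrightarrow> C * 0 * (C * 0 + 1)"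
    using \<rho> by (intro tendsto_intros LIMSEQ_power_zero) auto
  then have "\<forall>\<^sub>F n in sequentially. C * (1 / \<rho>) ^ n * (C * (1 / \<rho>) ^ n + 1) < e"
    using e by (intro order_tendstoD) auto
  then have "\<forall>\<^sub>F n in sequentially. 1 \<le> n \<and> C / \<rho> ^ n * (C / \<rho> ^ n + 1) < e"
    using eventually_ge_at_top[of 1] by eventually_elim (simp add: power_one_over)
  then obtain n where n: "1 \<le> n" "C / \<rho> ^ n * (C / \<rho> ^ n + 1) < e"
    using eventually_happens'[OF sequentially_bot] by blast
  \<comment> \<open>Radius 1 suffices, as the small factor comes from \<open>v\<close>.\<close>
  define U where "U = {y \<in> topspace X. B n y *v w \<in> ball (B n x *v w) 1}"
  have "continuous_on UNIV (\<lambda>C::real^2^2. C *v w)"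
    unfolding matrix_vector_mult_def by (intro continuous_intros)
  then have "continuous_map X euclidean (\<lambda>y. B n y *v w)"
    using continuous_map_compose[OF cont[of n], of euclidean "\<lambda>C. C *v w"] by (simp add: o_def)
  then have "openin X U"
    unfolding U_def by (rule openin_continuous_map_preimage) simp
  moreover have "x \<in> U"
    using x by (simp add: U_def)
  moreover have "\<bar>wedge v w\<bar> < e" if y: "y \<in> U" "v \<in> s y" "norm v = 1" for y v
  proof -
    have Y: "y \<in> topspace X" "norm (B n x *v w - B n y *v w) < 1"
      using y by (auto simp: U_def dist_norm)
    have "norm (B n y *v w) \<le> norm (B n x *v w) + 1"
      using Y(2) norm_triangle_ineq3[of "B n x *v w" "B n y *v w"] by linarith
    also have "\<dots> \<le> C / \<rho> ^ n + 1"
      using decay n x by simp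
    finally have *: "norm (B n y *v w) \<le> C / \<rho> ^ n + 1" .
    have v: "norm (B n y *v v) \<le> C / \<rho> ^ n"
      using decay n y Y by simp
    have "\<bar>wedge v w\<bar> \<le> norm (B n y *v v) * norm (B n y *v w)"
      using Y SL2 by (intro abs_wedge_le_SL2) auto
    also have "\<dots> \<le> C / \<rho> ^ n * (C / \<rho> ^ n + 1)"
      using v * order_trans[OF norm_ge_zero v] by (intro mult_mono) auto
    finally show ?thesis
      using n(2) by linarith
  qed
  ultimately show "\<exists>U. openin X U \<and> x \<in> U \<and> (\<forall>y\<in>U. \<forall>v\<in>s y. norm v = 1 \<longrightarrow> \<bar>wedge v w\<bar> < e)"
    by blast
qed

section \<open>Continuity of the cocycle and of matrix inversion\<close>

lemma continuous_map_matrix_mult: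
  fixes f g :: "'a \<Rightarrow> real^2^2"
  assumes "continuous_map X euclidean f" "continuous_map X euclidean g"
  shows "continuous_map X euclidean (\<lambda>x. f x ** g x)"
  using assms unfolding continuous_map_atin limitin_canonical_iff matrix_matrix_mult_def
  by (intro ballI tendsto_intros) auto

lemma continuous_on_matrix_inv_SL2: "continuous_on SL2 matrix_inv"
proof -
  have "continuous_on SL2 (\<lambda>B. matrix_inv B $ i $ j)" for i j
  proof -
    have "continuous_on SL2 (\<lambda>B. (vector [vector [B$2$2, - B$1$2], vector [- B$2$1, B$1$1]] :: real^2^2) $ i $ j)"
      using exhaust_2[of i] exhaust_2[of j]
      by (elim disjE) (simp_all only: vector_2, (intro continuous_intros)+)
    then show ?thesis
      by (rule continuous_on_eq) (simp add: matrix_inv_SL2)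
  qed
  then have "continuous_on SL2 (\<lambda>B. \<chi> i j. matrix_inv B $ i $ j)"
    by (intro continuous_on_vec_lambda)
  then show ?thesis
    by simp
qed

lemma continuous_map_funpow: "continuous_map X X f \<Longrightarrow> continuous_map X X (f ^^ n)"
  by (induction n) (auto intro: continuous_map_compose simp: id_def[symmetric])

lemma continuous_map_forward_cocycle:
  assumes "continuous_map X X T" "continuous_map X euclidean A"
  shows "continuous_map X euclidean (forward_cocycle T A n)"
proof (induction n)
  case (Suc n)
  have "continuous_map X euclidean (\<lambda>x. A ((T ^^ n) x))"
    using continuous_map_compose[OF continuous_map_funpow[OF assms(1)] assms(2)] by (simp add: o_def)
  from continuous_map_matrix_mult[OF this Suc] show ?case
    by simp
qed simp

section \<open>Negative iterates as a forward cocycle over the inverse map\<close>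

lemma forward_cocycle_inverse:
  assumes "T' \<in> \<Omega> \<rightarrow> \<Omega>" "\<And>x. x \<in> \<Omega> \<Longrightarrow> T (T' x) = x"
    and T: "T \<in> \<Omega> \<rightarrow> \<Omega>" and A: "A \<in> \<Omega> \<rightarrow> SL2" and "\<omega> \<in> \<Omega>"
  shows "forward_cocycle T' (\<lambda>x. matrix_inv (A (T' x))) n \<omega>
    = matrix_inv (forward_cocycle T A n ((T' ^^ n) \<omega>))"
proof (induction n)
  case 0
  show ?case
    using matrix_inv_SL2_left[of "mat 1"] by (simp add: SL2_def)
next
  case (Suc n)
  have in_\<Omega>: "(T' ^^ m) \<omega> \<in> \<Omega>" for m
    using assms(1,5) by (rule funpow_in)
  \<comment> \<open>Starting one step earlier adds a factor on the right; inversion moves it to the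
    left, where the cocycle over \<open>T'\<close> adds its own.\<close>
  have "forward_cocycle T A (Suc n) ((T' ^^ Suc n) \<omega>)
      = forward_cocycle T A n ((T' ^^ n) \<omega>) ** A (T' ((T' ^^ n) \<omega>))"
    using assms(2)[OF in_\<Omega>[of n]] by (simp add: forward_cocycle_Suc_right del: forward_cocycle.simps)
  moreover have "A (T' ((T' ^^ n) \<omega>)) \<in> SL2"
    using A in_\<Omega>[of "Suc n"] by auto
  ultimately show ?case
    using forward_cocycle_SL2[OF T A in_\<Omega>[of n]] by (simp add: Suc matrix_inv_mult_SL2)
qed

lemma cocycle_of_nat: "cocycle \<Omega> T A (int n) \<omega> = forward_cocycle T A n \<omega>"
  by (simp add: cocycle_def)

lemma cocycle_minus_of_nat:
  assumes "bij_betw T \<Omega> \<Omega>" "A \<in> \<Omega> \<rightarrow> SL2" "\<omega> \<in> \<Omega>"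
  shows "cocycle \<Omega> T A (- int n) \<omega>
    = forward_cocycle (inv_into \<Omega> T) (\<lambda>x. matrix_inv (A (inv_into \<Omega> T x))) n \<omega>"
\<comment> \<open>Time 0 falls under the branch of \<open>cocycle\<close> for nonnegative
  times.\<close>
proof (cases "n = 0")
  case False
  have "forward_cocycle (inv_into \<Omega> T) (\<lambda>x. matrix_inv (A (inv_into \<Omega> T x))) n \<omega>
      = matrix_inv (forward_cocycle T A n ((inv_into \<Omega> T ^^ n) \<omega>))"
  proof (rule forward_cocycle_inverse)
    show "inv_into \<Omega> T \<in> \<Omega> \<rightarrow> \<Omega>" "T \<in> \<Omega> \<rightarrow> \<Omega>"
      using bij_betw_imp_funcset[OF bij_betw_inv_into[OF assms(1)]] bij_betw_imp_funcset[OF assms(1)]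
      by auto
    show "T (inv_into \<Omega> T x) = x" if "x \<in> \<Omega>" for x
      using bij_betw_inv_into_right[OF assms(1) that] .
  qed (use assms in auto)
  then show ?thesis
    using False by (simp add: cocycle_def iterate_def)
qed (simp add: cocycle_def)

text \<open>Puts the unstable directions into the form of stable directions of the inverse cocycle,
  so that both are handled by the same lemmas.\<close>

lemma unstable_stable_directions_iff:
  assumes "bij_betw T \<Omega> \<Omega>" "A \<in> \<Omega> \<rightarrow> SL2"
  defines "T' \<equiv> inv_into \<Omega> T"
  defines "A' \<equiv> \<lambda>x. matrix_inv (A (T' x))"
  shows "unstable_stable_directions \<Omega> T A u s \<longleftrightarrow>
     u \<in> \<Omega> \<rightarrow> lines \<and> s \<in> \<Omega> \<rightarrow> lines \<and>
     (\<forall>\<omega>\<in>\<Omega>. projective_action (A \<omega>) (u \<omega>) = u (T \<omega>) \<and>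
             projective_action (A \<omega>) (s \<omega>) = s (T \<omega>)) \<and>
     (\<exists>C>0. \<exists>\<rho>>1. \<forall>n::nat. 1 \<le> n \<longrightarrow> (\<forall>\<omega>\<in>\<Omega>.
        (\<forall>v\<in>u \<omega>. norm v = 1 \<longrightarrow> norm (forward_cocycle T' A' n \<omega> *v v) \<le> C / \<rho> ^ n) \<and>
        (\<forall>w\<in>s \<omega>. norm w = 1 \<longrightarrow> norm (forward_cocycle T A n \<omega> *v w) \<le> C / \<rho> ^ n)))"
  using assms(1,2) unfolding unstable_stable_directions_def T'_def A'_def
  by (simp add: cocycle_of_nat cocycle_minus_of_nat power_int_minus divide_inverse cong: ball_cong)

theorem corollary1:
  fixes X :: "'a topology" and T :: "'a \<Rightarrow> 'a" and A :: "'a \<Rightarrow> real^2^2"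
  assumes "compact_space X"
    and "homeomorphic_map X X T"
    and "continuous_map X (top_of_set SL2) A"
  shows "(uniformly_hyperbolic (topspace X) T A \<longleftrightarrow>
           (\<exists>c>0. \<exists>\<rho>>1. \<forall>n::nat. 1 \<le> n \<longrightarrow> (\<forall>\<omega>\<in>topspace X.
              onorm (\<lambda>v. cocycle (topspace X) T A (int n) \<omega> *v v) \<ge> c * \<rho> ^ n))) \<and>
         (\<forall>u s. unstable_stable_directions (topspace X) T A u s \<longrightarrow>
           continuous_map X RP1 u \<and> continuous_map X RP1 s)"
proof -
  define \<Omega> where "\<Omega> = topspace X"
  define T' where "T' = inv_into \<Omega> T"
  define A' where "A' = (\<lambda>x. matrix_inv (A (T' x)))"
  have bij: "bij_betw T \<Omega> \<Omega>"
    using assms(2) by (auto simp: \<Omega>_def bij_betw_def homeomorphic_eq_everything_map)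
  have T: "T \<in> \<Omega> \<rightarrow> \<Omega>" and T': "T' \<in> \<Omega> \<rightarrow> \<Omega>"
    using bij_betw_imp_funcset[OF bij] bij_betw_imp_funcset[OF bij_betw_inv_into[OF bij]]
    by (auto simp: T'_def)
  have TT': "T (T' x) = x" "T' (T x) = x" if "x \<in> \<Omega>" for x
    using bij_betw_inv_into_right[OF bij that] bij_betw_inv_into_left[OF bij that] by (simp_all add: T'_def)
  have A: "A \<in> \<Omega> \<rightarrow> SL2" and cont_A: "continuous_map X euclidean A"
    using assms(3) by (auto simp: continuous_map_in_subtopology \<Omega>_def)
  have A': "A' \<in> \<Omega> \<rightarrow> SL2"
    using A T' by (auto simp: A'_def intro!: matrix_inv_in_SL2)
  have cont_T: "continuous_map X X T"
    using assms(2) by (rule homeomorphic_imp_continuous_map)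
  have cont_T': "continuous_map X X T'"
  proof -
    \<comment> \<open>The continuous inverse \<open>g\<close> agrees with \<open>T'\<close> on
      \<open>\<Omega>\<close>, which transfers its continuity.\<close>
    obtain g where g: "homeomorphic_maps X X T g"
      using assms(2) homeomorphic_map_maps by blast
    then have "continuous_map X X g" "\<And>x. x \<in> \<Omega> \<Longrightarrow> g x \<in> \<Omega> \<and> T (g x) = x"
      by (auto simp: homeomorphic_maps_def \<Omega>_def continuous_map_def)
    then show ?thesis
      using TT' T' by (intro continuous_map_eq[of X X g T']) (metis \<Omega>_def)+
  qed
  have cont_A': "continuous_map X euclidean A'"
    using continuous_map_compose[OF continuous_map_compose[OF cont_T' assms(3)], of euclidean matrix_inv]
      continuous_on_matrix_inv_SL2
    by (simp add: A'_def o_def)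
  note usd_iff = unstable_stable_directions_iff[OF bij A, folded T'_def, folded A'_def]
  have continuous: "continuous_map X RP1 u \<and> continuous_map X RP1 s"
    if "unstable_stable_directions \<Omega> T A u s" for u s
  proof -
    obtain C \<rho> where lines: "u \<in> \<Omega> \<rightarrow> lines" "s \<in> \<Omega> \<rightarrow> lines" and \<rho>: "1 < \<rho>"
      and decay: "\<And>n \<omega> v. 1 \<le> n \<Longrightarrow> \<omega> \<in> \<Omega> \<Longrightarrow> v \<in> u \<omega> \<Longrightarrow> norm v = 1 \<Longrightarrow> norm (forward_cocycle T' A' n \<omega> *v v) \<le> C / \<rho> ^ n"
        "\<And>n \<omega> w. 1 \<le> n \<Longrightarrow> \<omega> \<in> \<Omega> \<Longrightarrow> w \<in> s \<omega> \<Longrightarrow> norm w = 1 \<Longrightarrow> norm (forward_cocycle T A n \<omega> *v w) \<le> C / \<rho> ^ n"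
      using \<open>unstable_stable_directions \<Omega> T A u s\<close> unfolding usd_iff by blast
    show ?thesis
      using lines decay \<rho> forward_cocycle_SL2[OF T A] forward_cocycle_SL2[OF T' A']
        continuous_map_forward_cocycle[OF cont_T cont_A] continuous_map_forward_cocycle[OF cont_T' cont_A']
      unfolding \<Omega>_def by (intro conjI) (rule continuous_map_uniformly_decaying_lines; blast)+
  qed
  \<comment> \<open>The stable directions alone force growth: a unimodular matrix that shrinks a
    unit vector has norm at least the reciprocal of the shrunken length.\<close>
  have forward: "\<exists>c>0. \<exists>\<rho>>1. \<forall>n::nat. 1 \<le> n \<longrightarrow> (\<forall>\<omega>\<in>\<Omega>. onorm (\<lambda>v. forward_cocycle T A n \<omega> *v v) \<ge> c * \<rho> ^ n)"
    if "unstable_stable_directions \<Omega> T A u s" for u s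
  proof -
    obtain C \<rho> where lines: "s \<in> \<Omega> \<rightarrow> lines" and \<rho>: "1 < \<rho>" and C: "0 < C"
      and decay: "\<And>n \<omega> w. 1 \<le> n \<Longrightarrow> \<omega> \<in> \<Omega> \<Longrightarrow> w \<in> s \<omega> \<Longrightarrow> norm w = 1 \<Longrightarrow> norm (forward_cocycle T A n \<omega> *v w) \<le> C / \<rho> ^ n"
      using \<open>unstable_stable_directions \<Omega> T A u s\<close> unfolding usd_iff by blast
    \<comment> \<open>The factor 2 pays for the passage from the Frobenius norm to the operator
      norm.\<close>
    have "1 / (2 * C) * \<rho> ^ n \<le> onorm (\<lambda>v. forward_cocycle T A n \<omega> *v v)" if n: "1 \<le> n" "\<omega> \<in> \<Omega>" for n \<omega>
    proof -
      obtain w where w: "w \<in> s \<omega>" "norm w = 1"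
        using lines n lines_unit_vector by blast
      let ?B = "forward_cocycle T A n \<omega>"
      have "1 \<le> norm ?B * norm (?B *v w)"
        using norm_le_SL2[OF forward_cocycle_SL2[OF T A n(2)], of w] w by simp
      also have "\<dots> \<le> norm ?B * (C / \<rho> ^ n)"
        using decay n w by (intro mult_left_mono) auto
      finally have "\<rho> ^ n / C \<le> norm ?B"
        using C \<rho> by (simp add: field_simps)
      then show ?thesis
        using norm_mat2_le_onorm[of ?B] by simp
    qed
    then show ?thesis
      using C \<rho> by (intro exI[of _ "1 / (2 * C)"] exI[of _ \<rho>] conjI) auto
  qed
  have backward: "\<exists>u s. unstable_stable_directions \<Omega> T A u s"
    if c: "0 < c" and \<rho>: "1 < \<rho>"
      and growth: "\<And>n \<omega>. 1 \<le> n \<Longrightarrow> \<omega> \<in> \<Omega> \<Longrightarrow> c * \<rho> ^ n \<le> onorm (\<lambda>v. forward_cocycle T A n \<omega> *v v)"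
    for c \<rho>
  proof -
    have growth': "c * \<rho> ^ n \<le> norm (forward_cocycle T A n \<omega>)" if "1 \<le> n" "\<omega> \<in> \<Omega>" for n \<omega>
      using growth[OF that] onorm_le_norm_mat2 by (rule order_trans)
    \<comment> \<open>Compactness enters here: it bounds \<open>A\<close>, and with it the inverse
      matrices, uniformly.\<close>
    have "compactin euclidean (A ` \<Omega>)"
      using assms(1) cont_A unfolding \<Omega>_def compact_space_def by (rule image_compactin)
    then have "bounded (A ` \<Omega>)"
      by (simp add: compact_imp_bounded)
    then obtain M where M: "\<And>\<omega>. \<omega> \<in> \<Omega> \<Longrightarrow> norm (A \<omega>) \<le> M"
      by (auto simp: bounded_iff)
    have M': "norm (A' \<omega>) \<le> M" if "\<omega> \<in> \<Omega>" for \<omega>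
    proof -
      have "T' \<omega> \<in> \<Omega>"
        using T' that by blast
      then show ?thesis
        using M A unfolding A'_def by (subst norm_matrix_inv_SL2) auto
    qed
    have growth_inverse: "c * \<rho> ^ n \<le> norm (forward_cocycle T' A' n \<omega>)" if "1 \<le> n" "\<omega> \<in> \<Omega>" for n \<omega>
    proof -
      \<comment> \<open>The growth bound is uniform in the base point, so it may be read
        \<open>n\<close> steps back along the orbit, and inversion keeps the norm.\<close>
      have in_\<Omega>: "(T' ^^ n) \<omega> \<in> \<Omega>"
        using T' that(2) by (rule funpow_in)
      have "forward_cocycle T' A' n \<omega> = matrix_inv (forward_cocycle T A n ((T' ^^ n) \<omega>))"
        unfolding A'_def using T' TT'(1) T A that(2) by (rule forward_cocycle_inverse)
      then show ?thesis
        using growth'[OF that(1) in_\<Omega>] forward_cocycle_SL2[OF T A in_\<Omega>]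
        by (simp add: norm_matrix_inv_SL2)
    qed
    obtain s C1 \<kappa>1 where s: "s \<in> \<Omega> \<rightarrow> lines"
      "\<And>\<omega>. \<omega> \<in> \<Omega> \<Longrightarrow> projective_action (A \<omega>) (s \<omega>) = s (T \<omega>)" "0 < C1" "1 < \<kappa>1"
      "\<And>n \<omega> w. \<omega> \<in> \<Omega> \<Longrightarrow> w \<in> s \<omega> \<Longrightarrow> norm w = 1 \<Longrightarrow> norm (forward_cocycle T A n \<omega> *v w) \<le> C1 / \<kappa>1 ^ n"
      using stable_directions_exist[OF T A M c \<rho> growth'] by blast
    obtain u C2 \<kappa>2 where u: "u \<in> \<Omega> \<rightarrow> lines"
      "\<And>\<omega>. \<omega> \<in> \<Omega> \<Longrightarrow> projective_action (A' \<omega>) (u \<omega>) = u (T' \<omega>)" "0 < C2" "1 < \<kappa>2"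
      "\<And>n \<omega> w. \<omega> \<in> \<Omega> \<Longrightarrow> w \<in> u \<omega> \<Longrightarrow> norm w = 1 \<Longrightarrow> norm (forward_cocycle T' A' n \<omega> *v w) \<le> C2 / \<kappa>2 ^ n"
      using stable_directions_exist[OF T' A' M' c \<rho> growth_inverse] by blast
    define C where "C = max C1 C2"
    define \<kappa> where "\<kappa> = min \<kappa>1 \<kappa>2"
    have C: "0 < C" and \<kappa>: "1 < \<kappa>"
      using s u by (auto simp: C_def \<kappa>_def)
    have le: "C1 / \<kappa>1 ^ n \<le> C / \<kappa> ^ n" "C2 / \<kappa>2 ^ n \<le> C / \<kappa> ^ n" for n
      using s(3,4) u(3,4) \<kappa> by (auto intro!: frac_le power_mono simp: C_def \<kappa>_def)
    \<comment> \<open>Invariance under the inverse cocycle, read at \<open>T \<omega>\<close>, maps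
      \<open>u (T \<omega>)\<close> to \<open>u \<omega>\<close> by
      \<open>matrix_inv (A \<omega>)\<close>; applying \<open>A \<omega>\<close> undoes
      this.\<close>
    have "projective_action (A \<omega>) (u \<omega>) = u (T \<omega>)" if "\<omega> \<in> \<Omega>" for \<omega>
    proof -
      have "u \<omega> = projective_action (matrix_inv (A \<omega>)) (u (T \<omega>))"
        using u(2)[of "T \<omega>"] T that by (auto simp: A'_def TT')
      moreover have "A \<omega> \<in> SL2"
        using A that by blast
      ultimately show ?thesis
        by (simp add: projective_action_def image_image matrix_inv_SL2_cancel)
    qed
    then have "unstable_stable_directions \<Omega> T A u s"
      unfolding usd_iff using s u C \<kappa> le
      by (intro conjI exI[of _ C] exI[of _ \<kappa>]) (auto intro: order_trans[OF _ le(1)] order_trans[OF _ le(2)])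
    then show ?thesis
      by blast
  qed
  show ?thesis
    using continuous forward backward
    unfolding uniformly_hyperbolic_def cocycle_of_nat \<Omega>_def by meson
qed

end
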